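(* Let $M$ be a compact connected smooth manifold, possibly with smooth boundary. If $\partial M\neq\emptyset$, fix one of the Dirichlet or Neumann boundary conditions. Then every smooth Riemannian metric $g$ on $M$ whose Laplace--Beltrami spectrum is simple is uniquely determined by its local Weyl counting function. That is, if $g$ and $g'$ are smooth Riemannian metrics on $M$, both having simple Laplace--Beltrami spectrum (with the fixed boundary condition if $\partial M\ne\emptyset$), and $$N_g(x,\lambda)=N_{g'}(x,\lambda)\qquad\text{for all }x\in M\text{ and all }\lambda\in\mathbb{R},$$ then $g=g'$ as metric tensors on $M$.
   Context: For a smooth Riemannian metric $g$ on a compact connected manifold $M$ (with Dirichlet, or Neumann, boundary condition if the smooth boundary $\partial M$ is nonempty), let $\Delta_g$ be the Laplace--Beltrami operator and let $\{e_{\lambda_j}\}_{j\ge1}$ be a (real) orthonormal basis of $L^2(M,dV_g)$ consisting of eigenfunctions, $-\Delta_g e_{\lambda_j}=\lambda_j^2e_{\lambda_j}$, where $0\le\lambda_1\le\lambda_2\le\cdots$ are listed with multiplicity. The local Weyl counting function of $(M,g)$ is $$N_g(x,\lambda)=\sum_{\lambda_j\le\lambda}|e_{\lambda_j}(x)|^2,\qquad x\in M,\ \lambda\in\mathbb{R}.$$ It does not depend on the choice of the orthonormal basis. The spectrum of $(M,g)$ is called simple if every eigenvalue of $-\Delta_g$ (with the given boundary condition) has multiplicity one. *)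

theory Defs
  imports "HOL-Analysis.Analysis"
begin

section \<open>Smooth functions on subsets of Euclidean space\<close>

text \<open>\<open>Ck_on k W f\<close> is meant for open \<open>W\<close>: \<open>f\<close> is \<open>k\<close> times continuously differentiable on \<open>W\<close>.\<close>

primrec Ck_on :: "nat \<Rightarrow> 'a::euclidean_space set \<Rightarrow> ('a \<Rightarrow> 'b::euclidean_space) \<Rightarrow> bool" where
  "Ck_on 0 W f \<longleftrightarrow> continuous_on W f"
| "Ck_on (Suc k) W f \<longleftrightarrow>
     (\<forall>x\<in>W. f differentiable (at x)) \<and>
     (\<forall>v. Ck_on k W (\<lambda>x. frechet_derivative f (at x) v))"

text \<open>On an arbitrary set \<open>S\<close> (for instance a relatively open subset of a half-space), smoothness
  means local extendability to a smooth function on an open set.\<close>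

definition smooth_on :: "'a::euclidean_space set \<Rightarrow> ('a \<Rightarrow> 'b::euclidean_space) \<Rightarrow> bool" where
  "smooth_on S f \<longleftrightarrow>
     (\<forall>x\<in>S. \<exists>W F. open W \<and> x \<in> W \<and> (\<forall>k. Ck_on k W F) \<and> (\<forall>y\<in>S \<inter> W. F y = f y))"

section \<open>Smooth manifolds with boundary\<close>

text \<open>The model half-space is bounded by a coordinate hyperplane; as the index type carries no order,
  the distinguished coordinate is an arbitrary fixed one.\<close>

definition normal_index :: "'n::finite" where
  "normal_index = (SOME i. True)"

definition half_space :: "(real ^ 'n) set" where
  "half_space = {y. 0 \<le> y $ normal_index}"

type_synonym ('m, 'n) chart = "'m set \<times> ('m \<Rightarrow> real ^ 'n)"

text \<open>\<open>chart_image c\<close> is the coordinate domain, \<open>chart_inv c\<close> the parametrization.\<close>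

definition chart_image :: "('m, 'n::finite) chart \<Rightarrow> (real ^ 'n) set" where
  "chart_image c = snd c ` fst c"

definition chart_inv :: "('m, 'n::finite) chart \<Rightarrow> real ^ 'n \<Rightarrow> 'm" where
  "chart_inv c = inv_into (fst c) (snd c)"

definition is_chart :: "'m topology \<Rightarrow> ('m, 'n::finite) chart \<Rightarrow> bool" where
  "is_chart M c \<longleftrightarrow>
     openin M (fst c) \<and>
     (open (chart_image c) \<or> openin (top_of_set half_space) (chart_image c)) \<and>
     homeomorphic_map (subtopology M (fst c)) (top_of_set (chart_image c)) (snd c)"

definition transition :: "('m, 'n::finite) chart \<Rightarrow> ('m, 'n) chart \<Rightarrow> real ^ 'n \<Rightarrow> real ^ 'n" where
  "transition c d = snd d \<circ> chart_inv c"

definition smooth_atlas :: "'m topology \<Rightarrow> ('m, 'n::finite) chart set \<Rightarrow> bool" where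
  "smooth_atlas M A \<longleftrightarrow>
     (\<forall>c\<in>A. is_chart M c) \<and>
     (\<Union>c\<in>A. fst c) = topspace M \<and>
     (\<forall>c\<in>A. \<forall>d\<in>A. smooth_on (snd c ` (fst c \<inter> fst d)) (transition c d))"

definition smooth_manifold :: "'m topology \<Rightarrow> ('m, 'n::finite) chart set \<Rightarrow> bool" where
  "smooth_manifold M A \<longleftrightarrow> Hausdorff_space M \<and> second_countable M \<and> smooth_atlas M A"

text \<open>A point lies on the boundary if some chart maps it to a point of the half-space that is not
  interior to the coordinate domain, i.e. onto the bounding hyperplane.\<close>

definition manifold_boundary :: "('m, 'n::finite) chart set \<Rightarrow> 'm set" where
  "manifold_boundary A =
     {x. \<exists>c\<in>A. x \<in> fst c \<and> snd c x \<notin> interior (chart_image c)}"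

definition smooth_fun :: "('m, 'n::finite) chart set \<Rightarrow> ('m \<Rightarrow> real) \<Rightarrow> bool" where
  "smooth_fun A u \<longleftrightarrow> (\<forall>c\<in>A. smooth_on (chart_image c) (u \<circ> chart_inv c))"

section \<open>Riemannian metrics\<close>

text \<open>A 2-tensor field is given by its component matrices in the charts of the atlas:
  \<open>g c x $ i $ j\<close> is the value at \<open>x\<close> on the coordinate vector fields \<open>i\<close> and \<open>j\<close> of \<open>c\<close>.
  Only the values with \<open>x \<in> fst c\<close> are meaningful.\<close>

type_synonym ('m, 'n) tensor2 = "('m, 'n) chart \<Rightarrow> 'm \<Rightarrow> real ^ 'n ^ 'n"

definition riemannian_metric ::
    "('m, 'n::finite) chart set \<Rightarrow> ('m, 'n) tensor2 \<Rightarrow> bool" where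
  "riemannian_metric A g \<longleftrightarrow>
     (\<forall>c\<in>A. smooth_on (chart_image c) (\<lambda>y. g c (chart_inv c y))) \<and>
     (\<forall>c\<in>A. \<forall>x\<in>fst c. transpose (g c x) = g c x \<and> (\<forall>v. v \<noteq> 0 \<longrightarrow> v \<bullet> (g c x *v v) > 0)) \<and>
     (\<forall>c\<in>A. \<forall>d\<in>A. \<forall>x\<in>fst c \<inter> fst d.
        let J = jacobian (transition c d) (at (snd c x) within snd c ` (fst c \<inter> fst d))
        in g c x = transpose J ** g d x ** J)"

text \<open>The volume measure is the unique Borel measure which in each chart has density
  \<open>sqrt (det g)\<close> with respect to Lebesgue measure.\<close>

definition is_riemannian_volume ::
    "'m topology \<Rightarrow> ('m, 'n::finite) chart set \<Rightarrow> ('m, 'n) tensor2 \<Rightarrow> 'm measure \<Rightarrow> bool" where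
  "is_riemannian_volume M A g V \<longleftrightarrow>
     space V = topspace M \<and>
     sets V = sigma_sets (topspace M) {U. openin M U} \<and>
     (\<forall>c\<in>A. \<forall>B\<in>sets V. B \<subseteq> fst c \<longrightarrow>
        emeasure V B =
          (\<integral>\<^sup>+ y\<in>snd c ` B. ennreal (sqrt (det (g c (chart_inv c y)))) \<partial>lborel))"

definition riemannian_volume ::
    "'m topology \<Rightarrow> ('m, 'n::finite) chart set \<Rightarrow> ('m, 'n) tensor2 \<Rightarrow> 'm measure" where
  "riemannian_volume M A g = (THE V. is_riemannian_volume M A g V)"

section \<open>The Laplace--Beltrami operator\<close>

text \<open>Derivatives are taken within the coordinate domain, hence are one-sided at boundary points.\<close>

definition partial :: "(real ^ 'n) set \<Rightarrow> 'n::finite \<Rightarrow> (real ^ 'n \<Rightarrow> real) \<Rightarrow> real ^ 'n \<Rightarrow> real" where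
  "partial S i f y = frechet_derivative f (at y within S) (axis i 1)"

text \<open>The coordinate expression
  \<open>(det g)\<^sup>-\<^sup>1\<^sup>/\<^sup>2 \<Sum>\<^sub>i \<partial>\<^sub>i (\<Sum>\<^sub>j (det g)\<^sup>1\<^sup>/\<^sup>2 g\<^sup>i\<^sup>j \<partial>\<^sub>j u)\<close> of the Laplacian in the chart \<open>c\<close>.
  For smooth \<open>u\<close> its value at a point does not depend on the chart.\<close>

definition laplacian ::
    "('m, 'n::finite) tensor2 \<Rightarrow> ('m, 'n) chart \<Rightarrow> ('m \<Rightarrow> real) \<Rightarrow> 'm \<Rightarrow> real" where
  "laplacian g c u x =
     (let S = chart_image c;
          G = (\<lambda>y. g c (chart_inv c y));
          w = (\<lambda>y. sqrt (det (G y)));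
          flux = (\<lambda>i y. \<Sum>j\<in>UNIV. w y * matrix_inv (G y) $ i $ j * partial S j (u \<circ> chart_inv c) y)
      in (\<Sum>i\<in>UNIV. partial S i (flux i) (snd c x)) / w (snd c x))"

datatype boundary_condition = Dirichlet | Neumann

text \<open>Components in the chart \<open>c\<close> of the outward unit normal at a boundary point \<open>x\<close>; in the half-space
  model the vectors tangent to the boundary are those with vanishing distinguished coordinate.\<close>

definition outward_unit_normal ::
    "('m, 'n::finite) tensor2 \<Rightarrow> ('m, 'n) chart \<Rightarrow> 'm \<Rightarrow> real ^ 'n \<Rightarrow> bool" where
  "outward_unit_normal g c x \<nu> \<longleftrightarrow>
     \<nu> \<bullet> (g c x *v \<nu>) = 1 \<and> \<nu> $ normal_index < 0 \<and>
     (\<forall>w. w $ normal_index = 0 \<longrightarrow> \<nu> \<bullet> (g c x *v w) = 0)"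

text \<open>Both conditions are vacuous if the boundary is empty.\<close>

fun satisfies_bc ::
    "boundary_condition \<Rightarrow> ('m, 'n::finite) chart set \<Rightarrow> ('m, 'n) tensor2 \<Rightarrow> ('m \<Rightarrow> real) \<Rightarrow> bool"
where
  "satisfies_bc Dirichlet A g u \<longleftrightarrow> (\<forall>x\<in>manifold_boundary A. u x = 0)"
| "satisfies_bc Neumann A g u \<longleftrightarrow>
     (\<forall>x\<in>manifold_boundary A. \<forall>c\<in>A. x \<in> fst c \<longrightarrow>
        (\<forall>\<nu>. outward_unit_normal g c x \<nu> \<longrightarrow>
           frechet_derivative (u \<circ> chart_inv c) (at (snd c x) within chart_image c) \<nu> = 0))"

definition laplace_eigenspace ::
    "boundary_condition \<Rightarrow> ('m, 'n::finite) chart set \<Rightarrow> ('m, 'n) tensor2 \<Rightarrow> real \<Rightarrow> ('m \<Rightarrow> real) set"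
where
  "laplace_eigenspace bc A g \<mu> =
     {u. smooth_fun A u \<and> satisfies_bc bc A g u \<and>
         (\<forall>c\<in>A. \<forall>x\<in>fst c. - laplacian g c u x = \<mu> * u x)}"

text \<open>Functions are compared on \<open>topspace M\<close> only: if the eigenspace contains a nonzero function,
  then it is spanned by one.\<close>

definition simple_spectrum ::
    "boundary_condition \<Rightarrow> 'm topology \<Rightarrow> ('m, 'n::finite) chart set \<Rightarrow> ('m, 'n) tensor2 \<Rightarrow> bool"
where
  "simple_spectrum bc M A g \<longleftrightarrow>
     (\<forall>\<mu>. (\<exists>u\<in>laplace_eigenspace bc A g \<mu>. \<exists>x\<in>topspace M. u x \<noteq> 0) \<longrightarrow>
        (\<exists>u\<in>laplace_eigenspace bc A g \<mu>. (\<exists>x\<in>topspace M. u x \<noteq> 0) \<and>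
           (\<forall>v\<in>laplace_eigenspace bc A g \<mu>. \<exists>a. \<forall>x\<in>topspace M. v x = a * u x)))"

section \<open>Orthonormal eigenbases and the local Weyl counting function\<close>

definition L2 :: "'m measure \<Rightarrow> ('m \<Rightarrow> real) set" where
  "L2 V = {f \<in> borel_measurable V. integrable V (\<lambda>x. (f x)\<^sup>2)}"

definition L2_inner :: "'m measure \<Rightarrow> ('m \<Rightarrow> real) \<Rightarrow> ('m \<Rightarrow> real) \<Rightarrow> real" where
  "L2_inner V f h = (LINT x|V. f x * h x)"

definition L2_orthonormal_basis :: "'m measure \<Rightarrow> (nat \<Rightarrow> 'm \<Rightarrow> real) \<Rightarrow> bool" where
  "L2_orthonormal_basis V e \<longleftrightarrow>
     (\<forall>j. e j \<in> L2 V) \<and>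
     (\<forall>i j. L2_inner V (e i) (e j) = (if i = j then 1 else 0)) \<and>
     (\<forall>f\<in>L2 V. (\<lambda>n. LINT x|V. (f x - (\<Sum>j<n. L2_inner V f (e j) * e j x))\<^sup>2) \<longlonglongrightarrow> 0)"

text \<open>\<open>lam j\<close> is the frequency of \<open>e j\<close>, the eigenvalue being \<open>(lam j)\<^sup>2\<close>. As \<open>e\<close> is a basis, the
  nondecreasing sequence \<open>lam\<close> lists the spectrum with multiplicity; indices start at 0.\<close>

definition laplace_eigenbasis ::
    "boundary_condition \<Rightarrow> 'm topology \<Rightarrow> ('m, 'n::finite) chart set \<Rightarrow> ('m, 'n) tensor2 \<Rightarrow>
     (nat \<Rightarrow> real) \<Rightarrow> (nat \<Rightarrow> 'm \<Rightarrow> real) \<Rightarrow> bool" where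
  "laplace_eigenbasis bc M A g lam e \<longleftrightarrow>
     (\<forall>j. 0 \<le> lam j) \<and> incseq lam \<and>
     (\<forall>j. e j \<in> laplace_eigenspace bc A g ((lam j)\<^sup>2)) \<and>
     L2_orthonormal_basis (riemannian_volume M A g) e"

text \<open>For an eigenbasis on a compact manifold the frequencies tend to infinity, so the sum is finite;
  its value is the same for all eigenbases of a given metric.\<close>

definition local_weyl :: "(nat \<Rightarrow> real) \<Rightarrow> (nat \<Rightarrow> 'm \<Rightarrow> real) \<Rightarrow> 'm \<Rightarrow> real \<Rightarrow> real" where
  "local_weyl lam e x l = (\<Sum>j\<in>{j. lam j \<le> l}. \<bar>e j x\<bar>\<^sup>2)"

end

theory Submission
  imports Defs
begin

text \<open>
  The idea is that a Laplacian is determined by its action on a complete set of functions, and that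
  the local Weyl function hands over such a set up to signs.

  If the spectrum is simple, the counting function jumps at each frequency by the square of the single
  normalized eigenfunction, which is not identically zero. Hence the jumps give, one after the other,
  every frequency and every squared eigenfunction, and the two metrics share both
  (\<open>local_weyl_determines_frequencies_and_squares\<close>).

  Equality of squares means that \<open>e\<^sub>j = \<plusminus> e'\<^sub>j\<close> with a sign that is locally constant off the zero set.
  Differential operators do not see a locally constant sign, and on the interior of the zero set both
  functions vanish. These two open sets together are dense, so by continuity \<open>e\<^sub>j\<close> itself satisfies the
  eigenvalue equation of the second metric (\<open>eigenfunction_transfer_of_equal_squares\<close>).

  Let \<open>P\<close> and \<open>P'\<close> be the two operators \<open>div (a grad)\<close> in a chart, where \<open>a = w G\<^sup>-\<^sup>1\<close> and
  \<open>w = sqrt (det G)\<close>, so that \<open>P e\<^sub>j = - \<lambda>\<^sub>j\<^sup>2 w e\<^sub>j\<close> and \<open>P' e\<^sub>j = - \<lambda>\<^sub>j\<^sup>2 w' e\<^sub>j\<close>. For a test function \<open>\<psi>\<close>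
  supported inside the chart, both \<open>P \<psi>\<close> and \<open>P' (\<psi> w / w')\<close> integrate against \<open>e\<^sub>j\<close> to
  \<open>- \<lambda>\<^sub>j\<^sup>2 \<integral> w e\<^sub>j \<psi>\<close>, by Green's identity (\<open>green_compact_support\<close>). So
  \<open>(P \<psi> - P' (\<psi> w / w')) / w\<close> is orthogonal to the whole basis and vanishes by completeness
  (\<open>orthogonal_in_chart_imp_zero\<close>). The derivatives have been moved to the test function, which is why
  completeness in \<open>L\<^sup>2\<close> suffices.

  Finally, inserting test functions that vanish to second order at a point leaves only the principal
  symbols (\<open>div_grad_determines_coefficients\<close>) and yields \<open>w G\<^sup>-\<^sup>1 = (w / w') w' G'\<^sup>-\<^sup>1\<close>, that is
  \<open>G = G'\<close>, at interior points of the chart. Boundary points follow by continuity.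

  The Riemannian volume is defined by a uniquely determining property. That a measure with this
  property exists is the change of variables formula for the transition maps together with a finite
  gluing (\<open>ex1_volume\<close>).
\<close>

section \<open>Calculus of finitely often differentiable functions\<close>

lemma Ck_on_cong:
  fixes f g :: "'a::euclidean_space \<Rightarrow> 'b::euclidean_space"
  assumes "open W" "\<And>x. x \<in> W \<Longrightarrow> f x = g x" "Ck_on k W f"
  shows "Ck_on k W g"
  using assms(2,3)
proof (induction k arbitrary: f g)
  case 0
  then show ?case by (simp cong: continuous_on_cong)
next
  case (Suc k)
  have d: "f differentiable (at x)" if "x \<in> W" for x using Suc.prems that by simp
  have fr: "frechet_derivative f (at x) = frechet_derivative g (at x)" if "x \<in> W" for x
    using frechet_derivative_transform_within_open[OF d[OF that] \<open>open W\<close> that] Suc.prems(1) by blast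
  have "g differentiable (at x)" if "x \<in> W" for x
    using has_derivative_transform_within_open[OF _ \<open>open W\<close> that] d[OF that] Suc.prems(1)
    unfolding differentiable_def by blast
  moreover have "Ck_on k W (\<lambda>x. frechet_derivative g (at x) v)" for v
    by (rule Suc.IH[of "\<lambda>x. frechet_derivative f (at x) v"]) (use Suc.prems fr in auto)
  ultimately show ?case by simp
qed

lemma Ck_on_subset: "V \<subseteq> W \<Longrightarrow> Ck_on k W f \<Longrightarrow> Ck_on k V f"
  by (induction k arbitrary: f) (auto intro: continuous_on_subset)

lemma Ck_on_SucD: "Ck_on (Suc k) W f \<Longrightarrow> Ck_on k W f"
proof (induction k arbitrary: f)
  case 0
  then show ?case
    by (auto intro!: continuous_at_imp_continuous_on differentiable_imp_continuous_within)
next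
  case (Suc k)
  then show ?case by auto
qed

lemma Ck_on_le: "k \<le> l \<Longrightarrow> Ck_on l W f \<Longrightarrow> Ck_on k W f"
  by (induction l rule: dec_induct) (auto dest: Ck_on_SucD simp del: Ck_on.simps)

lemma Ck_on_imp_continuous_on: "Ck_on k W f \<Longrightarrow> continuous_on W f"
  using Ck_on_le[of 0 k W f] by simp

text \<open>Smoothness on subsets is defined by local extensions, so regularity has to be checked locally.\<close>

lemma Ck_on_local:
  assumes "\<And>x. x \<in> W \<Longrightarrow> \<exists>V. open V \<and> x \<in> V \<and> Ck_on k V f"
  shows "Ck_on k W f"
  using assms
proof (induction k arbitrary: f)
  case 0
  show ?case unfolding Ck_on.simps
  proof (rule continuous_at_imp_continuous_on, rule ballI)
    fix x assume "x \<in> W"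
    then obtain V where "open V" "x \<in> V" "continuous_on V f" using 0 by auto
    then show "isCont f x" by (simp add: continuous_on_eq_continuous_at)
  qed
next
  case (Suc k)
  have "Ck_on k W (\<lambda>x. frechet_derivative f (at x) v)" for v
    by (rule Suc.IH) (use Suc.prems in fastforce)
  moreover have "\<forall>x\<in>W. f differentiable (at x)" using Suc.prems by fastforce
  ultimately show ?case by simp
qed

text \<open>Exhibiting any derivative suffices, whatever the choice operator in
  \<^const>\<open>frechet_derivative\<close> picks.\<close>

lemma Ck_on_SucI:
  assumes "open W" "\<And>x. x \<in> W \<Longrightarrow> (f has_derivative f' x) (at x)"
    and "\<And>v. Ck_on k W (\<lambda>x. f' x v)"
  shows "Ck_on (Suc k) W f"
proof -
  have fr: "frechet_derivative f (at x) = f' x" if "x \<in> W" for x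
    using frechet_derivative_at[OF assms(2)[OF that]] by simp
  have "Ck_on k W (\<lambda>x. frechet_derivative f (at x) v)" for v
    by (rule Ck_on_cong[OF assms(1) _ assms(3)[of v]]) (simp add: fr)
  moreover have "\<forall>x\<in>W. f differentiable (at x)" using assms(2) unfolding differentiable_def by blast
  ultimately show ?thesis by simp
qed

lemma Ck_on_SucE:
  assumes "Ck_on (Suc k) W f"
  shows "\<And>x. x \<in> W \<Longrightarrow> (f has_derivative frechet_derivative f (at x)) (at x)"
    and "\<And>v. Ck_on k W (\<lambda>x. frechet_derivative f (at x) v)"
  using assms by (auto simp: frechet_derivative_works)

lemma Ck_on_const: "Ck_on k W (\<lambda>x. c)"
  by (induction k arbitrary: c) auto

lemma Ck_on_bounded_linear_comp:
  assumes "open W" "bounded_linear L" "Ck_on k W f"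
  shows "Ck_on k W (\<lambda>x. L (f x))"
  using assms(3)
proof (induction k arbitrary: f)
  case 0
  then show ?case using bounded_linear.continuous_on[OF assms(2)] by simp
next
  case (Suc k)
  show ?case
    by (rule Ck_on_SucI[OF assms(1), where f' = "\<lambda>x v. L (frechet_derivative f (at x) v)"])
       (auto intro: bounded_linear.has_derivative[OF assms(2)] Ck_on_SucE[OF Suc.prems] Suc.IH)
qed

lemma Ck_on_ident: "open W \<Longrightarrow> Ck_on k W (\<lambda>x. x)"
  by (cases k) (auto intro!: Ck_on_SucI[where f' = "\<lambda>x v. v"] Ck_on_const simp del: Ck_on.simps(2))

lemma Ck_on_linear: "open W \<Longrightarrow> bounded_linear L \<Longrightarrow> Ck_on k W L"
  by (rule Ck_on_bounded_linear_comp) (auto intro: Ck_on_ident)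

lemma Ck_on_add:
  assumes "open W" "Ck_on k W f" "Ck_on k W g"
  shows "Ck_on k W (\<lambda>x. f x + g x)"
  using assms(2,3)
proof (induction k arbitrary: f g)
  case 0
  then show ?case by (auto intro: continuous_on_add)
next
  case (Suc k)
  show ?case
    by (rule Ck_on_SucI[OF assms(1), where f' = "\<lambda>x v. frechet_derivative f (at x) v + frechet_derivative g (at x) v"])
       (auto intro: has_derivative_add Ck_on_SucE[OF Suc.prems(1)] Ck_on_SucE[OF Suc.prems(2)] Suc.IH)
qed

lemma Ck_on_mult:
  fixes f g :: "'a::euclidean_space \<Rightarrow> real"
  assumes "open W" "Ck_on k W f" "Ck_on k W g"
  shows "Ck_on k W (\<lambda>x. f x * g x)"
  using assms(2,3)
proof (induction k arbitrary: f g)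
  case 0
  then show ?case by (auto intro: continuous_on_mult)
next
  case (Suc k)
  show ?case
    by (rule Ck_on_SucI[OF assms(1), where f' = "\<lambda>x v. f x * frechet_derivative g (at x) v + frechet_derivative f (at x) v * g x"])
       (auto intro!: has_derivative_mult Ck_on_add assms(1) Ck_on_SucE[OF Suc.prems(1)] Ck_on_SucE[OF Suc.prems(2)] Suc.IH
          Ck_on_SucD[OF Suc.prems(1)] Ck_on_SucD[OF Suc.prems(2)])
qed

lemma Ck_on_minus:
  fixes f :: "'a::euclidean_space \<Rightarrow> real"
  assumes "open W" "Ck_on k W f"
  shows "Ck_on k W (\<lambda>x. - f x)"
  using Ck_on_mult[OF assms(1) Ck_on_const[of k W "-1"] assms(2)] by simp

lemma Ck_on_diff:
  fixes f g :: "'a::euclidean_space \<Rightarrow> real"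
  assumes "open W" "Ck_on k W f" "Ck_on k W g"
  shows "Ck_on k W (\<lambda>x. f x - g x)"
  using Ck_on_add[OF assms(1,2) Ck_on_minus[OF assms(1,3)]] by simp

lemma Ck_on_sum:
  assumes "open W" "\<And>i. i \<in> I \<Longrightarrow> Ck_on k W (f i)"
  shows "Ck_on k W (\<lambda>x. \<Sum>i\<in>I. f i x)"
  using assms(2) by (induction I rule: infinite_finite_induct) (auto intro: Ck_on_const Ck_on_add assms(1))

lemma Ck_on_prod:
  fixes f :: "'i \<Rightarrow> 'a::euclidean_space \<Rightarrow> real"
  assumes "open W" "\<And>i. i \<in> I \<Longrightarrow> Ck_on k W (f i)"
  shows "Ck_on k W (\<lambda>x. \<Prod>i\<in>I. f i x)"
  using assms(2) by (induction I rule: infinite_finite_induct) (auto intro: Ck_on_const Ck_on_mult assms(1))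

lemma Ck_on_power:
  fixes f :: "'a::euclidean_space \<Rightarrow> real"
  assumes "open W" "Ck_on k W f"
  shows "Ck_on k W (\<lambda>x. f x ^ m)"
  by (induction m) (auto intro: Ck_on_const Ck_on_mult assms)

lemma Ck_on_inverse:
  fixes f :: "'a::euclidean_space \<Rightarrow> real"
  assumes "open W" "Ck_on k W f" "\<And>x. x \<in> W \<Longrightarrow> f x \<noteq> 0"
  shows "Ck_on k W (\<lambda>x. inverse (f x))"
  using assms(2)
proof (induction k)
  case 0
  then show ?case using assms(3) by (auto intro: continuous_on_inverse)
next
  case (Suc k)
  show ?case
    by (rule Ck_on_SucI[OF assms(1), where f' = "\<lambda>x v. - (inverse (f x) * frechet_derivative f (at x) v * inverse (f x))"])
       (auto intro!: Deriv.has_derivative_inverse Ck_on_minus Ck_on_mult Ck_on_SucE[OF Suc.prems] Suc.IH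
          Ck_on_SucD[OF Suc.prems] assms)
qed

lemma Ck_on_divide:
  fixes f g :: "'a::euclidean_space \<Rightarrow> real"
  assumes "open W" "Ck_on k W f" "Ck_on k W g" "\<And>x. x \<in> W \<Longrightarrow> g x \<noteq> 0"
  shows "Ck_on k W (\<lambda>x. f x / g x)"
  using Ck_on_mult[OF assms(1,2) Ck_on_inverse[OF assms(1,3,4)]] by (simp add: field_simps)

lemma Ck_on_sqrt:
  fixes f :: "'a::euclidean_space \<Rightarrow> real"
  assumes "open W" "Ck_on k W f" "\<And>x. x \<in> W \<Longrightarrow> f x > 0"
  shows "Ck_on k W (\<lambda>x. sqrt (f x))"
  using assms(2)
proof (induction k)
  case 0
  then show ?case by (auto intro: continuous_on_real_sqrt)
next
  case (Suc k)
  have pos: "f x > 0" if "x \<in> W" for x using assms(3) that .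
  have "((\<lambda>x. sqrt (f x)) has_derivative (\<lambda>v. frechet_derivative f (at x) v * inverse (2 * sqrt (f x)))) (at x)"
    if "x \<in> W" for x
  proof -
    have "(sqrt has_field_derivative inverse (sqrt (f x)) / 2) (at (f x))"
      using DERIV_real_sqrt[OF pos[OF that]] .
    from DERIV_compose_FDERIV[OF this Ck_on_SucE(1)[OF Suc.prems that]]
    show ?thesis by (simp add: field_simps)
  qed
  then show ?case
  proof (rule Ck_on_SucI[OF assms(1)])
    show "Ck_on k W (\<lambda>x. frechet_derivative f (at x) v * inverse (2 * sqrt (f x)))" for v
      by (intro Ck_on_inverse Ck_on_mult Ck_on_const Ck_on_SucE[OF Suc.prems] Suc.IH
          Ck_on_SucD[OF Suc.prems] assms(1)) (use pos in force)
  qed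
qed

text \<open>Powers of the positive part provide cutoff functions of any finite regularity, which is all
  that a second-order operator needs.\<close>

lemma has_field_derivative_max_power:
  fixes t :: real
  shows "((\<lambda>t. max 0 t ^ Suc (Suc k)) has_field_derivative real (Suc (Suc k)) * max 0 t ^ Suc k) (at t)"
proof -
  consider "t > 0" | "t < 0" | "t = 0" by linarith
  then show ?thesis
  proof cases
    case 1
    show ?thesis
      by (rule has_field_derivative_transform_within_open[where S = "{0<..}" and f = "\<lambda>t. t ^ Suc (Suc k)"])
         (use 1 DERIV_pow[of "Suc (Suc k)" t] in \<open>auto simp: max_def\<close>)
  next
    case 2
    show ?thesis
      by (rule has_field_derivative_transform_within_open[where S = "{..<0}" and f = "\<lambda>t. 0"])
         (use 2 in \<open>auto simp: max_def\<close>)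
  next
    case 3
    have "((\<lambda>h::real. max 0 h ^ Suc (Suc k) / h) \<longlongrightarrow> 0) (at 0)"
    proof (rule tendsto_eq_rhs)
      have "((\<lambda>h::real. max 0 h ^ Suc k) \<longlongrightarrow> max 0 0 ^ Suc k) (at 0)"
        by (intro tendsto_intros)
      then show "((\<lambda>h::real. max 0 h ^ Suc (Suc k) / h) \<longlongrightarrow> max 0 0 ^ Suc k) (at 0)"
      proof (rule Lim_transform_eventually)
        show "\<forall>\<^sub>F h::real in at 0. max 0 h ^ Suc k = max 0 h ^ Suc (Suc k) / h"
          by (rule eventually_at_filter[THEN iffD2, OF always_eventually]) (auto simp: max_def)
      qed
    qed simp
    then show ?thesis using 3 by (simp add: DERIV_def)
  qed
qed

lemma Ck_on_max_power:
  fixes f :: "'a::euclidean_space \<Rightarrow> real"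
  assumes "open W" "Ck_on k W f"
  shows "Ck_on k W (\<lambda>x. max 0 (f x) ^ Suc k)"
  using assms(2)
proof (induction k)
  case 0
  then show ?case by (auto intro!: continuous_intros)
next
  case (Suc k)
  show ?case
  proof (rule Ck_on_SucI[OF assms(1)])
    show "((\<lambda>x. max 0 (f x) ^ Suc (Suc k)) has_derivative
        (\<lambda>v. frechet_derivative f (at x) v * (real (Suc (Suc k)) * max 0 (f x) ^ Suc k))) (at x)" if "x \<in> W" for x
      using DERIV_compose_FDERIV[OF has_field_derivative_max_power Ck_on_SucE(1)[OF Suc.prems that]] .
    show "Ck_on k W (\<lambda>x. frechet_derivative f (at x) v * (real (Suc (Suc k)) * max 0 (f x) ^ Suc k))" for v
      by (intro Ck_on_mult Ck_on_const Ck_on_SucE[OF Suc.prems] Suc.IH Ck_on_SucD[OF Suc.prems] assms(1))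
  qed
qed

lemma smooth_on_imp_continuous_on: "smooth_on S f \<Longrightarrow> continuous_on S f"
proof (unfold continuous_on_eq_continuous_within, rule ballI)
  fix x assume S: "smooth_on S f" "x \<in> S"
  then obtain W F where W: "open W" "x \<in> W" "\<forall>k. Ck_on k W F" "\<forall>y\<in>S \<inter> W. F y = f y"
    unfolding smooth_on_def by blast
  have "isCont F x" using W(3)[rule_format, of 0] W(1,2) by (simp add: continuous_on_eq_continuous_at)
  then have "continuous (at x within S) F" by (rule continuous_at_imp_continuous_at_within)
  then show "continuous (at x within S) f"
  proof (rule continuous_transform_within_openin)
    show "openin (top_of_set S) (S \<inter> W)" using W(1) by (auto simp: openin_open)
  qed (use W S in auto)
qed

lemma smooth_on_differentiable_within:
  assumes "smooth_on S f" "x \<in> S"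
  shows "f differentiable (at x within S)"
proof -
  obtain W F where W: "open W" "x \<in> W" "\<forall>k. Ck_on k W F" "\<forall>y\<in>S \<inter> W. F y = f y"
    using assms unfolding smooth_on_def by blast
  have "F differentiable (at x)" using W(3)[rule_format, of 1] W(2) by simp
  then obtain D where "(F has_derivative D) (at x within S)"
    unfolding differentiable_def using has_derivative_at_withinI by blast
  moreover obtain d where "d > 0" "ball x d \<subseteq> W" using W(1,2) openE by blast
  ultimately have "(f has_derivative D) (at x within S)"
    using has_derivative_transform_within[of F D x S d f] W(4) assms(2)
    by (metis Int_iff dist_commute mem_ball subsetD)
  then show ?thesis unfolding differentiable_def by blast
qed

text \<open>At interior points a smooth function on a set coincides with its smooth local extensions.\<close>

lemma smooth_on_imp_Ck_on:
  assumes "smooth_on S f" "open U" "U \<subseteq> S"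
  shows "Ck_on k U f"
proof (rule Ck_on_local)
  fix x assume "x \<in> U"
  with assms(3) have "x \<in> S" by blast
  with assms(1) obtain W F where W: "open W" "x \<in> W" "\<forall>k. Ck_on k W F" "\<forall>y\<in>S \<inter> W. F y = f y"
    unfolding smooth_on_def by meson
  have "Ck_on k (U \<inter> W) f"
  proof (rule Ck_on_cong[of _ F])
    show "open (U \<inter> W)" using W(1) assms(2) by blast
    show "F x = f x" if "x \<in> U \<inter> W" for x using W(4) assms(3) that by blast
    show "Ck_on k (U \<inter> W) F" using W(3) Ck_on_subset by blast
  qed
  then show "\<exists>V. open V \<and> x \<in> V \<and> Ck_on k V f"
    using W(1,2) \<open>x \<in> U\<close> assms(2) by (intro exI[of _ "U \<inter> W"]) auto
qed

section \<open>Green's identity and operators in divergence form\<close>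

text \<open>By translation invariance of Lebesgue measure the difference quotients of \<open>F\<close> integrate to
  zero. They converge boundedly, with supports in a common compact set, to the derivative.\<close>

lemma integral_derivative_compact_support:
  fixes F :: "'a::euclidean_space \<Rightarrow> real"
  assumes F: "Ck_on 1 UNIV F" and K: "compact K" and zero: "\<And>x. x \<notin> K \<Longrightarrow> F x = 0"
  shows "(\<integral>x. frechet_derivative F (at x) v \<partial>lborel) = 0"
proof -
  define D where "D = (\<lambda>x. frechet_derivative F (at x) v)"
  have der: "(F has_derivative frechet_derivative F (at x)) (at x)" for x
    using Ck_on_SucE(1)[of 0 UNIV F x] F by simp
  have contF: "continuous_on UNIV F" using Ck_on_imp_continuous_on[OF F] .
  have contD: "continuous_on UNIV D" using F by (simp add: D_def)
  have Dzero: "D x = 0" if "x \<notin> K" for x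
  proof -
    have "(F has_derivative (\<lambda>h. 0)) (at x)"
      by (rule has_derivative_transform_within_open[of "\<lambda>x. 0" _ _ _ "- K"])
         (use K zero that in \<open>auto simp: compact_imp_closed open_Compl\<close>)
    then have "frechet_derivative F (at x) = (\<lambda>h. 0)"
      using frechet_derivative_at by metis
    then show ?thesis by (simp add: D_def)
  qed
  obtain C where C: "\<And>x. \<bar>D x\<bar> \<le> C" and C0: "0 \<le> C"
  proof -
    have "bounded (D ` K)"
      by (intro compact_imp_bounded compact_continuous_image K continuous_on_subset[OF contD]) simp
    then obtain B where B: "\<And>x. x \<in> K \<Longrightarrow> \<bar>D x\<bar> \<le> B" unfolding bounded_iff by auto
    show thesis
    proof (rule that[of "max B 0"])
      show "\<bar>D x\<bar> \<le> max B 0" for x using B[of x] Dzero[of x] by (cases "x \<in> K") auto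
    qed simp
  qed
  \<comment> \<open>All difference quotients with step at most one are supported in this compact set.\<close>
  define K' where "K' = (\<lambda>(t, x). x - t *\<^sub>R v) ` ({0..1} \<times> K)"
  have K': "compact K'" unfolding K'_def
    by (intro compact_continuous_image compact_Times K) (auto intro!: continuous_intros simp: case_prod_unfold)
  define s where "s n x = real (Suc n) * (F ((1 / real (Suc n)) *\<^sub>R v + x) - F x)" for n x
  have intF: "integrable lborel F"
  proof -
    have "(\<lambda>x. indicator K x *\<^sub>R F x) = F" using zero by (auto simp: indicator_def fun_eq_iff)
    then show ?thesis using borel_integrable_compact[OF K continuous_on_subset[OF contF]] by auto
  qed
  have trans: "integrable lborel (\<lambda>x. F (c + x))" "(\<integral>x. F (c + x) \<partial>lborel) = (\<integral>x. F x \<partial>lborel)" for c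
  proof -
    have m: "F \<in> borel_measurable borel" using contF borel_measurable_continuous_onI by blast
    show "integrable lborel (\<lambda>x. F (c + x))"
      by (rule integrable_distr[of _ _ borel]) (use intF lborel_distr_plus[of c] in auto)
    show "(\<integral>x. F (c + x) \<partial>lborel) = (\<integral>x. F x \<partial>lborel)"
      using integral_distr[of "(+) c" lborel borel F] m lborel_distr_plus[of c] by simp
  qed
  have s0: "(\<integral>x. s n x \<partial>lborel) = 0" for n
    unfolding s_def using trans intF by simp
  have line: "((\<lambda>t. F (t *\<^sub>R v + x)) has_real_derivative D (t *\<^sub>R v + x)) (at t)" for t x
  proof -
    have "((\<lambda>t. F (t *\<^sub>R v + x)) has_derivative (\<lambda>h. frechet_derivative F (at (t *\<^sub>R v + x)) (h *\<^sub>R v))) (at t)"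
      by (rule has_derivative_compose[OF _ der]) (auto intro!: derivative_eq_intros)
    moreover have "frechet_derivative F (at (t *\<^sub>R v + x)) (h *\<^sub>R v) = D (t *\<^sub>R v + x) * h" for h
      using linear_cmul[OF has_derivative_linear[OF der]] by (simp add: D_def mult.commute)
    ultimately show ?thesis by (simp add: has_field_derivative_def)
  qed
  have bound: "\<bar>s n x\<bar> \<le> C * indicator K' x" for n x
  proof (cases "x \<in> K'")
    case True
    let ?h = "1 / real (Suc n)"
    obtain t where t: "F (?h *\<^sub>R v + x) - F (0 *\<^sub>R v + x) = (?h - 0) * D (t *\<^sub>R v + x)"
      using MVT2[of 0 ?h "\<lambda>t. F (t *\<^sub>R v + x)" "\<lambda>t. D (t *\<^sub>R v + x)"] line by auto
    then have "s n x = D (t *\<^sub>R v + x)" by (simp add: s_def)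
    then show ?thesis using C True by simp
  next
    case False
    have "x \<notin> K" 
    proof
      assume "x \<in> K"
      then have "x \<in> K'" unfolding K'_def by (intro image_eqI[of _ _ "(0, x)"]) auto
      with False show False by simp
    qed
    moreover have "(1 / real (Suc n)) *\<^sub>R v + x \<notin> K"
    proof
      assume "(1 / real (Suc n)) *\<^sub>R v + x \<in> K"
      then have "x \<in> K'" unfolding K'_def
        by (intro image_eqI[of _ _ "(1 / real (Suc n), (1 / real (Suc n)) *\<^sub>R v + x)"]) auto
      with False show False by simp
    qed
    ultimately show ?thesis using False zero by (simp add: s_def)
  qed
  have lim: "(\<lambda>n. s n x) \<longlonglongrightarrow> D x" for x
  proof -
    have "((\<lambda>h. (F (h *\<^sub>R v + x) - F x) / h) \<longlongrightarrow> D x) (at 0)"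
      using line[of x 0] by (simp add: DERIV_def)
    moreover have "filterlim (\<lambda>n. 1 / real (Suc n)) (at 0) sequentially"
      using LIMSEQ_inverse_real_of_nat by (auto simp: filterlim_at inverse_eq_divide)
    ultimately have "(\<lambda>n. (F ((1 / real (Suc n)) *\<^sub>R v + x) - F x) / (1 / real (Suc n))) \<longlonglongrightarrow> D x"
      by (rule filterlim_compose)
    then show ?thesis by (simp add: s_def mult.commute)
  qed
  have smeas: "s n \<in> borel_measurable lborel" for n
    unfolding s_def using trans(1)[of "(1 / real (Suc n)) *\<^sub>R v"] intF by auto
  have wint: "integrable lborel (\<lambda>x. C * indicator K' x)"
    using borel_integrable_compact[OF K' continuous_on_const[of _ C]] by (simp add: mult.commute)
  have "(\<lambda>n. \<integral>x. s n x \<partial>lborel) \<longlonglongrightarrow> (\<integral>x. D x \<partial>lborel)"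
  proof (rule integral_dominated_convergence[OF _ smeas wint])
    show "D \<in> borel_measurable lborel" using borel_measurable_continuous_onI[OF contD] by simp
    show "AE x in lborel. (\<lambda>n. s n x) \<longlonglongrightarrow> D x" using lim by simp
    show "AE x in lborel. norm (s n x) \<le> C * indicator K' x" for n using bound by simp
  qed
  then show ?thesis unfolding s0 D_def using LIMSEQ_unique tendsto_const by blast
qed

definition coord_deriv :: "'n::finite \<Rightarrow> (real ^ 'n \<Rightarrow> real) \<Rightarrow> real ^ 'n \<Rightarrow> real" where
  "coord_deriv i f y = frechet_derivative f (at y) (axis i 1)"

text \<open>The operator \<open>div (a grad u)\<close>; the Laplace--Beltrami operator takes this form after
  multiplication by the volume density.\<close>

definition div_grad :: "(real ^ 'n \<Rightarrow> real ^ 'n ^ 'n) \<Rightarrow> (real ^ 'n::finite \<Rightarrow> real) \<Rightarrow> real ^ 'n \<Rightarrow> real" where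
  "div_grad a u y = (\<Sum>i\<in>UNIV. coord_deriv i (\<lambda>z. \<Sum>j\<in>UNIV. a z $ i $ j * coord_deriv j u z) y)"

text \<open>Derivatives are local even where they do not exist: the choice operator is applied to the same
  predicate.\<close>

lemma coord_deriv_cong:
  assumes "open N" "y \<in> N" "\<And>z. z \<in> N \<Longrightarrow> f z = g z"
  shows "coord_deriv i f y = coord_deriv i g y"
proof -
  have "(f has_derivative D) (at y) \<longleftrightarrow> (g has_derivative D) (at y)" for D
    using has_derivative_transform_within_open[OF _ assms(1,2)] assms(3) by metis
  then show ?thesis unfolding coord_deriv_def frechet_derivative_def by simp
qed

lemma coord_deriv_eqI: "(f has_derivative D) (at y) \<Longrightarrow> coord_deriv i f y = D (axis i 1)"
  unfolding coord_deriv_def using frechet_derivative_at by metis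

lemma div_grad_cong:
  assumes "open N" "y \<in> N" "\<And>z. z \<in> N \<Longrightarrow> u z = v z"
  shows "div_grad a u y = div_grad a v y"
  unfolding div_grad_def
proof (rule sum.cong[OF refl])
  fix i
  show "coord_deriv i (\<lambda>z. \<Sum>j\<in>UNIV. a z $ i $ j * coord_deriv j u z) y =
        coord_deriv i (\<lambda>z. \<Sum>j\<in>UNIV. a z $ i $ j * coord_deriv j v z) y"
    by (rule coord_deriv_cong[OF assms(1,2)])
       (use coord_deriv_cong[OF assms(1) _ assms(3)] in \<open>auto intro!: sum.cong\<close>)
qed

lemma Ck_on_coord_deriv: "Ck_on (Suc k) W f \<Longrightarrow> Ck_on k W (coord_deriv i f)"
  unfolding coord_deriv_def[abs_def] by simp

lemma Ck_on_flux:
  assumes "open W" "\<And>i j. Ck_on k W (\<lambda>z. a z $ i $ j)" "Ck_on (Suc k) W u"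
  shows "Ck_on k W (\<lambda>z. \<Sum>j\<in>UNIV. a z $ i $ j * coord_deriv j u z)"
  by (intro Ck_on_sum Ck_on_mult assms(1,2) Ck_on_coord_deriv assms(3))

lemma Ck_on_div_grad:
  assumes "open W" "\<And>i j. Ck_on (Suc k) W (\<lambda>z. a z $ i $ j)" "Ck_on (Suc (Suc k)) W u"
  shows "Ck_on k W (div_grad a u)"
  unfolding div_grad_def[abs_def] by (intro Ck_on_sum Ck_on_coord_deriv Ck_on_flux assms)

lemma coord_deriv_mult:
  assumes "f differentiable at y" "g differentiable at y"
  shows "coord_deriv i (\<lambda>z. f z * g z) y = f y * coord_deriv i g y + coord_deriv i f y * g y"
  using coord_deriv_eqI[OF has_derivative_mult[OF assms[unfolded frechet_derivative_works]]]
  by (simp add: coord_deriv_def)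

lemma coord_deriv_diff:
  assumes "f differentiable at y" "g differentiable at y"
  shows "coord_deriv i (\<lambda>z. f z - g z) y = coord_deriv i f y - coord_deriv i g y"
  using coord_deriv_eqI[OF has_derivative_diff[OF assms[unfolded frechet_derivative_works]]]
  by (simp add: coord_deriv_def)

lemma div_grad_0: "div_grad a (\<lambda>_. 0) y = 0"
  by (simp add: div_grad_def coord_deriv_def)

lemma integrable_compact_support:
  fixes f :: "'a::euclidean_space \<Rightarrow> real"
  assumes "continuous_on U f" "compact K" "K \<subseteq> U" "\<And>x. x \<in> U - K \<Longrightarrow> f x = 0"
  shows "integrable lborel (\<lambda>x. indicator U x * f x)"
proof -
  have "(\<lambda>x. indicator U x * f x) = (\<lambda>x. indicator K x *\<^sub>R f x)"
    using assms(3,4) by (auto simp: indicator_def fun_eq_iff)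
  then show ?thesis using borel_integrable_compact[OF assms(2) continuous_on_subset[OF assms(1,3)]] by simp
qed

text \<open>Green's second identity: the difference \<open>u L\<psi> - \<psi> Lu\<close> is the divergence of a compactly
  supported field, the terms with two first derivatives cancelling by symmetry of the coefficients.\<close>

lemma green_compact_support:
  fixes a :: "real ^ 'n \<Rightarrow> real ^ 'n::finite ^ 'n"
  assumes U: "open U" and a: "\<And>i j. Ck_on 1 U (\<lambda>z. a z $ i $ j)"
    and sym: "\<And>z i j. z \<in> U \<Longrightarrow> a z $ i $ j = a z $ j $ i"
    and u: "Ck_on 2 U u" and \<psi>: "Ck_on 2 U \<psi>"
    and K: "compact K" "K \<subseteq> U" and zero: "\<And>x. x \<in> U - K \<Longrightarrow> \<psi> x = 0"
  shows "(\<integral>x. indicator U x * (u x * div_grad a \<psi> x) \<partial>lborel) =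
         (\<integral>x. indicator U x * (div_grad a u x * \<psi> x) \<partial>lborel)" (is "?L = ?R")
proof -
  define flux where "flux v i z = (\<Sum>j\<in>UNIV. a z $ i $ j * coord_deriv j v z)" for v i z
  \<comment> \<open>Extension by zero is continuously differentiable, as the field vanishes near the edge of \<open>U\<close>.\<close>
  define F where "F i z = (if z \<in> U then u z * flux \<psi> i z - \<psi> z * flux u i z else 0)" for i z
  note two = numeral_2_eq_2 One_nat_def
  have fl: "Ck_on 1 U (flux v i)" if "Ck_on 2 U v" for v i
    unfolding flux_def[abs_def] by (rule Ck_on_flux[OF U]) (use a that in \<open>simp_all only: two\<close>)
  have u1: "Ck_on 1 U u" "Ck_on 1 U \<psi>" using u \<psi> Ck_on_le[of 1 2] by auto
  have Fc: "Ck_on 1 U (\<lambda>z. u z * flux \<psi> i z - \<psi> z * flux u i z)" for i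
    by (intro Ck_on_diff Ck_on_mult fl u \<psi> u1 U)
  have open': "open (U - K)" using U K(1) by (simp add: compact_imp_closed open_Diff)
  have cd0: "coord_deriv j \<psi> z = 0" if "z \<in> U - K" for j z
  proof -
    have "coord_deriv j \<psi> z = coord_deriv j (\<lambda>_. 0) z"
      by (rule coord_deriv_cong[OF open' that zero])
    then show ?thesis by (simp add: coord_deriv_def)
  qed
  have F0: "F i z = 0" if "z \<notin> K" for i z
    using cd0 zero that by (auto simp: F_def flux_def)
  have F1: "Ck_on 1 UNIV (F i)" for i
  proof (rule Ck_on_local)
    fix z
    show "\<exists>V. open V \<and> z \<in> V \<and> Ck_on 1 V (F i)"
    proof (cases "z \<in> U")
      case True
      have "Ck_on 1 U (F i)" by (rule Ck_on_cong[OF U _ Fc]) (simp add: F_def)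
      then show ?thesis using U True by blast
    next
      case False
      have "Ck_on 1 (- K) (F i)"
        by (rule Ck_on_cong[of _ "\<lambda>_. 0"]) (use F0 K in \<open>auto simp: compact_imp_closed open_Compl Ck_on_const simp del: One_nat_def\<close>)
      then show ?thesis using False K by (intro exI[of _ "- K"]) (auto simp: compact_imp_closed open_Compl)
    qed
  qed
  have int0: "(\<integral>x. coord_deriv i (F i) x \<partial>lborel) = 0" for i
    unfolding coord_deriv_def by (rule integral_derivative_compact_support[OF F1 K(1)]) (use F0 in auto)
  have diff: "v differentiable at z" if "Ck_on 1 U v" "z \<in> U" for v and z :: "real ^ 'n"
    using that by simp
  have div: "(\<Sum>i\<in>UNIV. coord_deriv i (F i) z) = indicator U z * (u z * div_grad a \<psi> z) - indicator U z * (div_grad a u z * \<psi> z)" for z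
  proof (cases "z \<in> U")
    case True
    have "coord_deriv i (F i) z = (u z * coord_deriv i (flux \<psi> i) z - \<psi> z * coord_deriv i (flux u i) z)
        + (coord_deriv i u z * flux \<psi> i z - coord_deriv i \<psi> z * flux u i z)" for i
    proof -
      have "coord_deriv i (F i) z = coord_deriv i (\<lambda>z. u z * flux \<psi> i z - \<psi> z * flux u i z) z"
        by (rule coord_deriv_cong[OF U True]) (simp add: F_def)
      also have "\<dots> = coord_deriv i (\<lambda>z. u z * flux \<psi> i z) z - coord_deriv i (\<lambda>z. \<psi> z * flux u i z) z"
        by (intro coord_deriv_diff diff Ck_on_mult U u1 fl u \<psi> True)
      also have "\<dots> = (u z * coord_deriv i (flux \<psi> i) z + coord_deriv i u z * flux \<psi> i z)
          - (\<psi> z * coord_deriv i (flux u i) z + coord_deriv i \<psi> z * flux u i z)"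
        by (subst (1 2) coord_deriv_mult) (auto intro!: diff U u1 fl u \<psi> True simp del: One_nat_def)
      finally show ?thesis by simp
    qed
    then have "(\<Sum>i\<in>UNIV. coord_deriv i (F i) z) =
       u z * (\<Sum>i\<in>UNIV. coord_deriv i (flux \<psi> i) z) - \<psi> z * (\<Sum>i\<in>UNIV. coord_deriv i (flux u i) z)
       + ((\<Sum>i\<in>UNIV. coord_deriv i u z * flux \<psi> i z) - (\<Sum>i\<in>UNIV. coord_deriv i \<psi> z * flux u i z))"
      by (simp add: sum.distrib sum_subtractf sum_distrib_left)
    moreover have "(\<Sum>i\<in>UNIV. coord_deriv i \<psi> z * flux u i z) = (\<Sum>i\<in>UNIV. coord_deriv i u z * flux \<psi> i z)"
    proof -
      have "(\<Sum>i\<in>UNIV. coord_deriv i \<psi> z * flux u i z) = (\<Sum>i\<in>UNIV. \<Sum>j\<in>UNIV. a z $ i $ j * coord_deriv i \<psi> z * coord_deriv j u z)"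
        by (simp add: flux_def sum_distrib_left mult_ac)
      also have "\<dots> = (\<Sum>j\<in>UNIV. \<Sum>i\<in>UNIV. a z $ i $ j * coord_deriv i \<psi> z * coord_deriv j u z)"
        by (rule sum.swap)
      also have "\<dots> = (\<Sum>j\<in>UNIV. \<Sum>i\<in>UNIV. a z $ j $ i * coord_deriv i \<psi> z * coord_deriv j u z)"
        using sym[OF True] by simp
      also have "\<dots> = (\<Sum>i\<in>UNIV. coord_deriv i u z * flux \<psi> i z)"
        by (simp add: flux_def sum_distrib_left mult_ac)
      finally show ?thesis .
    qed
    ultimately show ?thesis using True by (simp add: div_grad_def flux_def[abs_def])
  next
    case False
    have "coord_deriv i (F i) z = 0" for i
    proof -
      have "coord_deriv i (F i) z = coord_deriv i (\<lambda>_. 0) z"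
        by (rule coord_deriv_cong[of "- K"]) (use F0 K False in \<open>auto simp: compact_imp_closed open_Compl\<close>)
      then show ?thesis by (simp add: coord_deriv_def)
    qed
    then show ?thesis using False by simp
  qed
  have dg0: "div_grad a \<psi> z = 0" if "z \<in> U - K" for z
    using div_grad_cong[OF open' that zero] div_grad_0 by simp
  have cdg: "continuous_on U (div_grad a v)" if "Ck_on 2 U v" for v
    using Ck_on_div_grad[OF U, of 0 a v] a that by (simp add: two)
  have cu: "continuous_on U u" "continuous_on U \<psi>" using u \<psi> Ck_on_imp_continuous_on by auto
  have iL: "integrable lborel (\<lambda>x. indicator U x * (u x * div_grad a \<psi> x))"
    by (rule integrable_compact_support[OF _ K]) (auto intro!: continuous_intros cu cdg \<psi> simp: dg0)
  have iR: "integrable lborel (\<lambda>x. indicator U x * (div_grad a u x * \<psi> x))"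
    by (rule integrable_compact_support[OF _ K]) (auto intro!: continuous_intros cu cdg u simp: zero)
  have cF: "integrable lborel (\<lambda>x. coord_deriv i (F i) x)" for i
  proof -
    have "coord_deriv i (F i) z = 0" if "z \<notin> K" for z
    proof -
      have "coord_deriv i (F i) z = coord_deriv i (\<lambda>_. 0) z"
        by (rule coord_deriv_cong[of "- K"]) (use F0 K that in \<open>auto simp: compact_imp_closed open_Compl\<close>)
      then show ?thesis by (simp add: coord_deriv_def)
    qed
    moreover have "continuous_on UNIV (coord_deriv i (F i))" using Ck_on_coord_deriv[of 0 UNIV "F i" i] F1 by simp
    ultimately show ?thesis using integrable_compact_support[of UNIV "coord_deriv i (F i)" K] K by simp
  qed
  have "?L - ?R = (\<integral>x. (\<Sum>i\<in>UNIV. coord_deriv i (F i) x) \<partial>lborel)"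
    using iL iR by (simp add: div)
  also have "\<dots> = 0" using cF int0 by simp
  finally show ?thesis by simp
qed

text \<open>On test functions vanishing to second order at a point, the operator only sees its principal
  symbol there.\<close>

lemma div_grad_square_mult:
  fixes a :: "real ^ 'n \<Rightarrow> real ^ 'n::finite ^ 'n"
  assumes U: "open U" "x0 \<in> U" and a: "\<And>i j. Ck_on 1 U (\<lambda>z. a z $ i $ j)" and \<eta>: "Ck_on 2 U \<eta>"
  shows "div_grad a (\<lambda>y. (l \<bullet> (y - x0))\<^sup>2 * \<eta> y) x0 = 2 * \<eta> x0 * (l \<bullet> (a x0 *v l))"
proof -
  define q where "q y = l \<bullet> (y - x0)" for y
  have q_der: "(q has_derivative (\<lambda>h. l \<bullet> h)) (at y)" for y
    unfolding q_def[abs_def] by (auto intro!: derivative_eq_intros)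
  have q0: "q x0 = 0" by (simp add: q_def)
  \<comment> \<open>The flux is \<open>q m\<close>; as \<open>q\<close> vanishes at \<open>x0\<close>, its divergence there is \<open>m\<close> contracted with the
    gradient \<open>l\<close> of \<open>q\<close>.\<close>
  define m where "m i z = (\<Sum>j\<in>UNIV. a z $ i $ j * (2 * l $ j * \<eta> z + q z * coord_deriv j \<eta> z))" for i z
  have \<eta>1: "Ck_on 1 U \<eta>" using \<eta> Ck_on_le[of 1 2] by auto
  have qc: "Ck_on k U q" for k
  proof -
    have "Ck_on k U (\<lambda>y. l \<bullet> y - l \<bullet> x0)"
      by (intro Ck_on_diff Ck_on_const Ck_on_linear U bounded_linear_inner_right)
    then show ?thesis by (rule Ck_on_cong[OF U(1), rotated]) (simp add: q_def inner_diff_right)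
  qed
  have mc: "Ck_on 1 U (m i)" for i
    unfolding m_def[abs_def]
    by (intro Ck_on_sum Ck_on_mult Ck_on_add U a Ck_on_const \<eta>1 qc Ck_on_coord_deriv)
       (use \<eta> in \<open>simp add: numeral_2_eq_2\<close>)
  have cd: "coord_deriv j (\<lambda>y. (q y)\<^sup>2 * \<eta> y) z = q z * (2 * l $ j * \<eta> z + q z * coord_deriv j \<eta> z)" if "z \<in> U" for j z
  proof -
    have d: "(\<eta> has_derivative frechet_derivative \<eta> (at z)) (at z)"
      using Ck_on_SucE(1)[of 0 U \<eta> z] \<eta>1 that by simp
    have "((\<lambda>y. (q y)\<^sup>2 * \<eta> y) has_derivative
        (\<lambda>h. (q z)\<^sup>2 * frechet_derivative \<eta> (at z) h + 2 * q z * (l \<bullet> h) * \<eta> z)) (at z)"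
      by (rule derivative_eq_intros q_der d refl | simp add: mult_ac)+
    from coord_deriv_eqI[OF this, of j] show ?thesis
      by (simp add: coord_deriv_def inner_axis algebra_simps power2_eq_square)
  qed
  have "coord_deriv i (\<lambda>z. \<Sum>j\<in>UNIV. a z $ i $ j * coord_deriv j (\<lambda>y. (q y)\<^sup>2 * \<eta> y) z) x0 = l $ i * m i x0" for i
  proof -
    have "coord_deriv i (\<lambda>z. \<Sum>j\<in>UNIV. a z $ i $ j * coord_deriv j (\<lambda>y. (q y)\<^sup>2 * \<eta> y) z) x0
        = coord_deriv i (\<lambda>z. q z * m i z) x0"
    proof (rule coord_deriv_cong[OF U])
      fix z assume z: "z \<in> U"
      show "(\<Sum>j\<in>UNIV. a z $ i $ j * coord_deriv j (\<lambda>y. (q y)\<^sup>2 * \<eta> y) z) = q z * m i z"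
        unfolding cd[OF z] m_def sum_distrib_left by (simp add: mult_ac)
    qed
    also have "\<dots> = q x0 * coord_deriv i (m i) x0 + coord_deriv i q x0 * m i x0"
    proof (rule coord_deriv_mult)
      show "q differentiable at x0" using q_der differentiableI by blast
      show "m i differentiable at x0" using mc[of i] U(2) by simp
    qed
    also have "coord_deriv i q x0 = l $ i" using coord_deriv_eqI[OF q_der] by (simp add: inner_axis)
    finally show ?thesis by (simp add: q0)
  qed
  then have "div_grad a (\<lambda>y. (q y)\<^sup>2 * \<eta> y) x0 = (\<Sum>i\<in>UNIV. l $ i * m i x0)"
    by (simp add: div_grad_def)
  also have "\<dots> = 2 * \<eta> x0 * (l \<bullet> (a x0 *v l))"
    by (simp add: m_def q0 inner_vec_def matrix_vector_mult_def sum_distrib_left mult_ac)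
  finally show ?thesis by (simp add: q_def)
qed

lemma symmetric_matrix_eqI:
  fixes B C :: "real ^ 'n::finite ^ 'n"
  assumes "transpose B = B" "transpose C = C" "\<And>l. l \<bullet> (B *v l) = l \<bullet> (C *v l)"
  shows "B = C"
proof -
  define E where "E = B - C"
  have t: "E $ i $ j = E $ j $ i" for i j
  proof -
    have "B $ i $ j = transpose B $ i $ j" "C $ i $ j = transpose C $ i $ j" by (simp_all only: assms(1,2))
    then show ?thesis by (simp add: E_def transpose_def)
  qed
  have q: "l \<bullet> (E *v l) = 0" for l
    using assms(3)[of l] by (simp add: E_def matrix_vector_mult_diff_rdistrib inner_diff_right)
  have ent: "axis i 1 \<bullet> (E *v axis j 1) = E $ i $ j" for i j
    by (simp add: inner_axis' matrix_vector_mult_basis column_def)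
  have "E $ i $ j = 0" for i j
    using q[of "axis i 1 + axis j 1"] q[of "axis i 1"] q[of "axis j 1"] t[of i j]
    by (simp add: matrix_vector_right_distrib inner_add_left inner_add_right ent)
  then show ?thesis by (simp add: E_def vec_eq_iff)
qed

text \<open>Multiplying the argument by \<open>r\<close> changes the operator only by lower-order terms and by the factor
  \<open>r\<close> in the principal symbol. A symmetric principal symbol is known once its quadratic form is, and
  squares of linear functions vanishing at the point, cut off to compact support, recover the form.\<close>

lemma div_grad_determines_coefficients:
  fixes a b :: "real ^ 'n \<Rightarrow> real ^ 'n::finite ^ 'n"
  assumes U: "open U" "x0 \<in> U" and a: "\<And>i j. Ck_on 1 U (\<lambda>z. a z $ i $ j)" and b: "\<And>i j. Ck_on 1 U (\<lambda>z. b z $ i $ j)"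
    and sym: "transpose (a x0) = a x0" "transpose (b x0) = b x0"
    and r: "Ck_on 2 U r"
    and eq: "\<And>\<psi> K. Ck_on 2 U \<psi> \<Longrightarrow> compact K \<Longrightarrow> K \<subseteq> U \<Longrightarrow> (\<And>x. x \<in> U - K \<Longrightarrow> \<psi> x = 0) \<Longrightarrow>
       div_grad a \<psi> x0 = div_grad b (\<lambda>y. \<psi> y * r y) x0"
  shows "a x0 = r x0 *\<^sub>R b x0"
proof (rule symmetric_matrix_eqI)
  obtain \<rho> where \<rho>: "\<rho> > 0" "cball x0 \<rho> \<subseteq> U" using U open_contains_cball by blast
  \<comment> \<open>The third power of the positive part makes this bump function twice continuously differentiable.\<close>
  define \<eta> where "\<eta> y = max 0 (\<rho>\<^sup>2 - (\<Sum>i\<in>UNIV. (y $ i - x0 $ i)\<^sup>2)) ^ Suc 2" for y :: "real ^ 'n"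
  have \<eta>c: "Ck_on 2 U \<eta>"
    unfolding \<eta>_def[abs_def]
    by (intro Ck_on_max_power Ck_on_diff Ck_on_sum Ck_on_power Ck_on_const U(1) Ck_on_linear bounded_linear_vec_nth)
  have sq: "(\<Sum>i\<in>UNIV. (y $ i - x0 $ i)\<^sup>2) = (dist x0 y)\<^sup>2" for y
    by (simp add: dist_vec_def L2_set_def dist_real_def sum_nonneg power2_commute)
  have \<eta>0: "\<eta> y = 0" if "y \<notin> cball x0 \<rho>" for y
  proof -
    have "\<rho>\<^sup>2 \<le> (dist x0 y)\<^sup>2" using that \<rho>(1) by (intro power_mono) auto
    then show ?thesis by (simp add: \<eta>_def sq)
  qed
  have \<eta>1: "\<eta> x0 > 0" using \<rho>(1) by (simp add: \<eta>_def)
  fix l :: "real ^ 'n"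
  have lc: "Ck_on 2 U (\<lambda>y. (l \<bullet> (y - x0))\<^sup>2)"
  proof -
    have "Ck_on 2 U (\<lambda>y. (l \<bullet> y - l \<bullet> x0)\<^sup>2)"
      by (intro Ck_on_power Ck_on_diff Ck_on_const Ck_on_linear U(1) bounded_linear_inner_right)
    then show ?thesis by (rule Ck_on_cong[OF U(1), rotated]) (simp add: inner_diff_right)
  qed
  have "div_grad a (\<lambda>y. (l \<bullet> (y - x0))\<^sup>2 * \<eta> y) x0 = div_grad b (\<lambda>y. (l \<bullet> (y - x0))\<^sup>2 * \<eta> y * r y) x0"
    by (rule eq[OF _ compact_cball \<rho>(2)]) (use \<eta>0 in \<open>auto intro!: Ck_on_mult U(1) lc \<eta>c\<close>)
  moreover have "div_grad b (\<lambda>y. (l \<bullet> (y - x0))\<^sup>2 * \<eta> y * r y) x0 = 2 * (\<eta> x0 * r x0) * (l \<bullet> (b x0 *v l))"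
    using div_grad_square_mult[OF U b Ck_on_mult[OF U(1) \<eta>c r], of l] by (simp add: mult.assoc)
  ultimately have "2 * \<eta> x0 * (l \<bullet> (a x0 *v l)) = 2 * (\<eta> x0 * r x0) * (l \<bullet> (b x0 *v l))"
    using div_grad_square_mult[OF U a \<eta>c, of l] by simp
  then show "l \<bullet> (a x0 *v l) = l \<bullet> ((r x0 *\<^sub>R b x0) *v l)"
    using \<eta>1 by (simp add: scaleR_matrix_vector_assoc[symmetric])
qed (use sym in \<open>simp_all add: transpose_scalar\<close>)

text \<open>The two functions agree up to a sign that is locally constant off the zero set, and
  on the interior of the zero set there is nothing to show; these two open sets together are dense.\<close>

lemma eigenfunction_transfer_of_equal_squares:
  fixes b :: "real ^ 'n \<Rightarrow> real ^ 'n::finite ^ 'n"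
  assumes U: "open U" and b: "\<And>i j. Ck_on 1 U (\<lambda>z. b z $ i $ j)"
    and u: "Ck_on 2 U u" and v: "Ck_on 2 U v" and w: "continuous_on U w"
    and sq: "\<And>y. y \<in> U \<Longrightarrow> (u y)\<^sup>2 = (v y)\<^sup>2"
    and v_eq: "\<And>y. y \<in> U \<Longrightarrow> div_grad b v y = w y * v y"
    and y: "y \<in> U"
  shows "div_grad b u y = w y * u y"
proof (rule ccontr)
  assume neq: "div_grad b u y \<noteq> w y * u y"
  define R where "R = (\<lambda>y. div_grad b u y - w y * u y)"
  have "Ck_on 0 U (div_grad b u)"
    by (rule Ck_on_div_grad[OF U]) (use b u in \<open>simp_all add: numeral_2_eq_2\<close>)
  then have Rc: "continuous_on U R" unfolding R_def
    using Ck_on_imp_continuous_on[OF u] w by (auto intro!: continuous_intros)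
  have cu: "continuous_on U u" "continuous_on U v" using u v Ck_on_imp_continuous_on by auto
  define N where "N = U \<inter> R -` (- {0})"
  have N: "open N" "y \<in> N" "N \<subseteq> U" "\<And>z. z \<in> N \<Longrightarrow> R z \<noteq> 0"
    using continuous_open_preimage[OF Rc U, of "- {0}"] y neq
    by (auto simp: N_def R_def)
  show False
  proof (cases "\<forall>z\<in>N. u z = 0")
    case True
    then have "div_grad b u y = 0" using div_grad_cong[OF N(1,2), of u "\<lambda>_. 0"] div_grad_0 by metis
    then show False using N True by (auto simp: R_def)
  next
    case False
    then obtain z where z: "z \<in> N" "u z \<noteq> 0" by blast
    then have "(u z)\<^sup>2 = (v z)\<^sup>2" using sq N(3) by blast
    then obtain s :: real where s: "s = 1 \<or> s = -1" "u z = s * v z"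
      by (metis mult_1 mult_minus1 power2_eq_iff)
    \<comment> \<open>Where \<open>u\<close> and \<open>s v\<close> have the same sign, equality of the squares forces \<open>u = s v\<close>.\<close>
    define P where "P = N \<inter> (\<lambda>x. u x * (s * v x)) -` {0<..}"
    have cN: "continuous_on N (\<lambda>x. u x * (s * v x))"
      using cu N(3) by (auto intro!: continuous_intros elim: continuous_on_subset)
    have P: "open P" unfolding P_def by (rule continuous_open_preimage[OF cN N(1)]) simp
    have "u z * (s * v z) > 0" unfolding s(2)[symmetric] using z(2) not_real_square_gt_zero by blast
    then have "z \<in> P" using z(1) by (simp add: P_def)
    have uv: "u x = s * v x" if "x \<in> P" for x
    proof -
      have "(u x)\<^sup>2 = (s * v x)\<^sup>2" using sq[of x] that N(3) s(1) by (auto simp: P_def)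
      moreover have "u x * (s * v x) > 0" using that by (simp add: P_def)
      ultimately show ?thesis
        by (metis mult_minus_left not_less_iff_gr_or_eq not_real_square_gt_zero neg_less_0_iff_less
            power2_eq_iff less_trans zero_less_mult_iff)
    qed
    have "div_grad b u z = div_grad b (\<lambda>x. s * v x) z" by (rule div_grad_cong[OF P \<open>z \<in> P\<close> uv])
    also have "\<dots> = s * div_grad b v z"
    proof -
      have v1: "Ck_on 1 U v" using v Ck_on_le[of 1 2] by auto
      have cd: "coord_deriv j (\<lambda>x. s * f x) x = s * coord_deriv j f x" if "f differentiable at x" for j f and x :: "real ^ 'n"
        using coord_deriv_mult[of "\<lambda>_. s" x f j] that by (simp add: coord_deriv_def)
      have "coord_deriv i (\<lambda>x. \<Sum>j\<in>UNIV. b x $ i $ j * coord_deriv j (\<lambda>x. s * v x) x) z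
         = s * coord_deriv i (\<lambda>x. \<Sum>j\<in>UNIV. b x $ i $ j * coord_deriv j v x) z" for i
      proof -
        have "coord_deriv i (\<lambda>x. \<Sum>j\<in>UNIV. b x $ i $ j * coord_deriv j (\<lambda>x. s * v x) x) z
          = coord_deriv i (\<lambda>x. s * (\<Sum>j\<in>UNIV. b x $ i $ j * coord_deriv j v x)) z"
          using z N(3) v1
          by (intro coord_deriv_cong[OF U]) (auto simp: cd sum_distrib_left mult_ac)
        also have "\<dots> = s * coord_deriv i (\<lambda>x. \<Sum>j\<in>UNIV. b x $ i $ j * coord_deriv j v x) z"
        proof (rule cd)
          have "Ck_on 1 U (\<lambda>x. \<Sum>j\<in>UNIV. b x $ i $ j * coord_deriv j v x)"
            by (rule Ck_on_flux[OF U]) (use b v in \<open>simp_all add: numeral_2_eq_2\<close>)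
          then show "(\<lambda>x. \<Sum>j\<in>UNIV. b x $ i $ j * coord_deriv j v x) differentiable at z"
            using z N(3) by auto
        qed
        finally show ?thesis .
      qed
      then show ?thesis by (simp add: div_grad_def sum_distrib_left)
    qed
    also have "\<dots> = w z * u z" using v_eq[of z] z N(3) s(2) by (auto simp: mult_ac)
    finally show False using N(4)[OF z(1)] by (simp add: R_def)
  qed
qed

section \<open>Change of variables over arbitrary finite index types\<close>

text \<open>Relabelling of coordinates. It preserves Lebesgue measure and determinants.\<close>

definition reindex :: "('m::finite \<Rightarrow> 'n::finite) \<Rightarrow> real ^ 'n \<Rightarrow> real ^ 'm" where
  "reindex f x = (\<chi> i. x $ f i)"

lemma linear_reindex: "linear (reindex f)"
  by (rule linearI) (simp_all add: reindex_def vec_eq_iff)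

lemma bounded_linear_reindex: "bounded_linear (reindex f)"
  using linear_conv_bounded_linear linear_reindex by blast

lemma continuous_on_reindex: "continuous_on S (reindex f)"
  using bounded_linear.continuous_on[OF bounded_linear_reindex continuous_on_id] by simp

lemma borel_measurable_reindex [measurable]: "reindex f \<in> borel_measurable borel"
  by (rule borel_measurable_continuous_onI) (rule continuous_on_reindex)

lemma reindex_reindex_inv:
  assumes "bij f"
  shows "reindex f (reindex (inv f) x) = x" "reindex (inv f) (reindex f y) = y"
  using assms by (simp_all add: reindex_def vec_eq_iff bij_is_inj bij_is_surj surj_f_inv_f inv_f_f)

lemma prod_Basis_vec: "(\<Prod>b\<in>Basis. (x :: real ^ 'n::finite) \<bullet> b) = (\<Prod>i\<in>UNIV. x $ i)"
proof -
  have "(\<Prod>b\<in>Basis. x \<bullet> b) = (\<Prod>b\<in>range (\<lambda>i. axis i 1). x \<bullet> b)"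
    by (rule prod.cong) (auto simp: Basis_vec_def)
  also have "\<dots> = (\<Prod>i\<in>UNIV. x $ i)"
    by (subst prod.reindex) (auto simp: inj_on_def axis_eq_axis inner_axis)
  finally show ?thesis .
qed

lemma lborel_distr_reindex:
  fixes f :: "'m::finite \<Rightarrow> 'n::finite"
  assumes f: "bij f"
  shows "distr lborel borel (reindex f) = lborel"
proof (rule lborel_eqI[symmetric])
  fix l u :: "real ^ 'm" assume le: "\<And>b. b \<in> Basis \<Longrightarrow> l \<bullet> b \<le> u \<bullet> b"
  have le': "l $ i \<le> u $ i" for i using le[of "axis i 1"] by (simp add: inner_axis)
  define l' u' where "l' = reindex (inv f) l" and "u' = reindex (inv f) u"
  have all: "(\<forall>i. P (f i)) \<longleftrightarrow> (\<forall>j. P j)" for P using bij_is_surj[OF f] by (metis surjD)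
  have "reindex f -` box l u = box l' u'"
  proof -
    have "x \<in> reindex f -` box l u \<longleftrightarrow> x \<in> box l' u'" for x
      using all[of "\<lambda>j. l $ inv f j < x $ j \<and> x $ j < u $ inv f j"] f
      by (simp add: mem_box_cart reindex_def l'_def u'_def bij_is_inj)
    then show ?thesis by blast
  qed
  then have "emeasure (distr lborel borel (reindex f)) (box l u) = emeasure lborel (box l' u')"
    by (subst emeasure_distr) auto
  also have "\<dots> = (\<Prod>b\<in>Basis. (u' - l') \<bullet> b)"
  proof (rule emeasure_lborel_box)
    fix b :: "real ^ 'n" assume "b \<in> Basis"
    then obtain i where "b = axis i 1" by (auto simp: Basis_vec_def)
    then show "l' \<bullet> b \<le> u' \<bullet> b" using le' by (simp add: inner_axis l'_def u'_def reindex_def)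
  qed
  also have "(\<Prod>b\<in>Basis. (u' - l') \<bullet> b) = (\<Prod>b\<in>Basis. (u - l) \<bullet> b)"
    unfolding prod_Basis_vec
    by (rule prod.reindex_bij_witness[of _ f "inv f"])
       (use f in \<open>auto simp: l'_def u'_def reindex_def bij_is_inj bij_is_surj surj_f_inv_f\<close>)
  finally show "emeasure (distr lborel borel (reindex f)) (box l u) = (\<Prod>b\<in>Basis. (u - l) \<bullet> b)" .
qed simp

lemma nn_integral_lborel_reindex:
  assumes f: "bij f" and h: "h \<in> borel_measurable borel"
  shows "(\<integral>\<^sup>+ x. h (reindex f x) \<partial>lborel) = (\<integral>\<^sup>+ y. h y \<partial>lborel)"
  using nn_integral_distr[of "reindex f" lborel borel h] h by (simp add: lborel_distr_reindex[OF f])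

lemma det_reindex:
  fixes A :: "real ^ 'n::finite ^ 'n" and f :: "'m::finite \<Rightarrow> 'n"
  assumes f: "bij f"
  shows "det (\<chi> i j. A $ f i $ f j) = det A"
proof -
  let ?h = "\<lambda>p x. if x \<in> UNIV then f (p (inv_into UNIV f x)) else x"
  have h: "?h p = map_permutation UNIV f p" for p
    using f by (auto simp: map_permutation_def fun_eq_iff restrict_id_def bij_is_surj)
  have bij: "bij_betw ?h {p. p permutes (UNIV :: 'm set)} {p. p permutes (UNIV :: 'n set)}"
    by (rule bij_betw_permutations) (use f in simp)
  have "det A = (\<Sum>p | p permutes (UNIV :: 'm set). of_int (sign (?h p)) * (\<Prod>i\<in>UNIV. A $ i $ ?h p i))"
    unfolding det_def by (rule sum.reindex_bij_betw[OF bij, symmetric])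
  also have "\<dots> = (\<Sum>p | p permutes (UNIV :: 'm set). of_int (sign p) * (\<Prod>i\<in>UNIV. A $ f i $ f (p i)))"
  proof (rule sum.cong[OF refl])
    fix p assume "p \<in> {p. p permutes (UNIV :: 'm set)}"
    then have "sign (?h p) = sign p" unfolding h using f by (auto intro!: sign_map_permutation simp: bij_is_inj)
    moreover have "(\<Prod>i\<in>UNIV. A $ i $ ?h p i) = (\<Prod>i\<in>UNIV. A $ f i $ f (p i))"
      using prod.reindex_bij_betw[OF f, of "\<lambda>i. A $ i $ ?h p i"] f by (simp add: bij_is_inj)
    ultimately show "of_int (sign (?h p)) * (\<Prod>i\<in>UNIV. A $ i $ ?h p i) =
        of_int (sign p) * (\<Prod>i\<in>UNIV. A $ f i $ f (p i))" by simp
  qed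
  finally show ?thesis by (simp add: det_def)
qed

text \<open>The change of variables theorem is stated for coordinates indexed by a well-ordered type. A
  well-ordered copy of the index type, with the order of an arbitrary enumeration, carries it over
  to every finite index type: neither side of the formula depends on the labelling.\<close>

typedef 'n ordered_index = "UNIV :: 'n set" morphisms raw_index ordered_index
  by simp

lemma bij_raw_index: "bij raw_index"
  by (rule bij_betw_byWitness[of _ ordered_index]) (simp_all add: raw_index_inverse ordered_index_inverse)

instance ordered_index :: (finite) finite
proof
  show "finite (UNIV :: 'a ordered_index set)"
    by (rule bij_betw_finite[OF bij_raw_index, THEN iffD2]) simp
qed

instantiation ordered_index :: (finite) wellorder
begin

definition less_eq_ordered_index :: "'a ordered_index \<Rightarrow> 'a ordered_index \<Rightarrow> bool" where
  "x \<le> y \<longleftrightarrow> to_nat_on UNIV (raw_index x) \<le> to_nat_on UNIV (raw_index y)"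

definition less_ordered_index :: "'a ordered_index \<Rightarrow> 'a ordered_index \<Rightarrow> bool" where
  "x < y \<longleftrightarrow> to_nat_on UNIV (raw_index x) < to_nat_on UNIV (raw_index y)"

instance
proof
  fix x y z :: "'a ordered_index"
  show "(x < y) = (x \<le> y \<and> \<not> y \<le> x)" "x \<le> x" "x \<le> y \<Longrightarrow> y \<le> z \<Longrightarrow> x \<le> z" "x \<le> y \<or> y \<le> x"
    by (auto simp: less_eq_ordered_index_def less_ordered_index_def)
  show "x = y" if "x \<le> y" "y \<le> x"
  proof -
    have "inj (to_nat_on (UNIV :: 'a set))" by (rule inj_on_to_nat_on) (rule countable_finite, simp)
    then show ?thesis using that by (auto simp: less_eq_ordered_index_def inj_eq raw_index_inject)
  qed
next
  fix P :: "'a ordered_index \<Rightarrow> bool" and a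
  assume step: "\<And>x. (\<And>y. y < x \<Longrightarrow> P y) \<Longrightarrow> P x"
  show "P a"
    by (induction a rule: measure_induct_rule[of "\<lambda>x. to_nat_on UNIV (raw_index x)"])
       (rule step, simp add: less_ordered_index_def)
qed

end

text \<open>For nonnegative functions both sides may be infinite; absolute integrability is then
  finiteness of the integral, so that the equivalence for integrable functions covers this case.\<close>

lemma nn_integral_change_of_variables_wellorder:
  fixes T :: "real ^ 'n::{finite,wellorder} \<Rightarrow> real ^ 'n::_" and f :: "real ^ 'n::_ \<Rightarrow> real"
  assumes S: "S \<in> sets borel" and TS: "T ` S \<in> sets borel"
    and der: "\<And>x. x \<in> S \<Longrightarrow> (T has_derivative T' x) (at x within S)"
    and inj: "inj_on T S"
    and nonneg: "\<And>y. y \<in> T ` S \<Longrightarrow> 0 \<le> f y"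
    and meas: "(\<lambda>y. indicator (T ` S) y * f y) \<in> borel_measurable borel"
      "(\<lambda>x. indicator S x * (\<bar>det (matrix (T' x))\<bar> * f (T x))) \<in> borel_measurable borel"
  shows "(\<integral>\<^sup>+ y. ennreal (f y) * indicator (T ` S) y \<partial>lborel) =
         (\<integral>\<^sup>+ x. ennreal (\<bar>det (matrix (T' x))\<bar> * f (T x)) * indicator S x \<partial>lborel)"
proof -
  define h where "h = (\<lambda>x. \<bar>det (matrix (T' x))\<bar> * f (T x))"
  have "S \<in> sets lebesgue" using S by simp
  then have cov: "h absolutely_integrable_on S \<and> integral S h = b \<longleftrightarrow>
      f absolutely_integrable_on (T ` S) \<and> integral (T ` S) f = b" for b
    using has_absolute_integral_change_of_variables[of S T T' "\<lambda>x. vec (f x) :: real ^ 1" "vec b", OF _ der inj]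
    unfolding absolutely_integrable_on_1_iff integral_on_1_eq h_def by simp
  have abs: "k absolutely_integrable_on R \<longleftrightarrow> (\<integral>\<^sup>+ x. ennreal (k x) * indicator R x \<partial>lborel) < \<infinity>"
    if "\<And>x. x \<in> R \<Longrightarrow> 0 \<le> k x" "(\<lambda>x. indicator R x * k x) \<in> borel_measurable borel" for k and R :: "(real ^ 'n::_) set"
  proof -
    have "k absolutely_integrable_on R \<longleftrightarrow> integrable lborel (\<lambda>x. indicator R x * k x)"
      unfolding set_integrable_def using that(2) by (simp add: integrable_completion)
    also have "\<dots> \<longleftrightarrow> (\<integral>\<^sup>+ x. ennreal (norm (indicator R x * k x)) \<partial>lborel) < \<infinity>"
      using that(2) by (simp add: integrable_iff_bounded)
    also have "(\<integral>\<^sup>+ x. ennreal (norm (indicator R x * k x)) \<partial>lborel) = (\<integral>\<^sup>+ x. ennreal (k x) * indicator R x \<partial>lborel)"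
      by (rule nn_integral_cong) (use that(1) in \<open>auto simp: indicator_def\<close>)
    finally show ?thesis .
  qed
  have h0: "0 \<le> h x" if "x \<in> S" for x using nonneg that by (simp add: h_def)
  have abs_f: "f absolutely_integrable_on (T ` S) \<longleftrightarrow> (\<integral>\<^sup>+ y. ennreal (f y) * indicator (T ` S) y \<partial>lborel) < \<infinity>"
    by (rule abs) (use nonneg meas in auto)
  have abs_h: "h absolutely_integrable_on S \<longleftrightarrow> (\<integral>\<^sup>+ x. ennreal (h x) * indicator S x \<partial>lborel) < \<infinity>"
    by (rule abs) (use h0 meas in \<open>auto simp: h_def\<close>)
  show ?thesis
  proof (cases "f absolutely_integrable_on (T ` S)")
    case True
    then have hh: "h absolutely_integrable_on S" "integral S h = integral (T ` S) f" using cov by auto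
    have "(\<integral>\<^sup>+ y. ennreal (f y) * indicator (T ` S) y \<partial>lborel) = ennreal (integral (T ` S) f)"
      by (rule nn_integral_has_integral_lebesgue') (use True nonneg in \<open>auto simp: absolutely_integrable_on_def\<close>)
    moreover have "(\<integral>\<^sup>+ x. ennreal (h x) * indicator S x \<partial>lborel) = ennreal (integral S h)"
      by (rule nn_integral_has_integral_lebesgue') (use hh(1) h0 in \<open>auto simp: absolutely_integrable_on_def\<close>)
    ultimately show ?thesis using hh(2) by (simp add: h_def)
  next
    case False
    then have "\<not> h absolutely_integrable_on S" using cov by auto
    then show ?thesis using False abs_f abs_h by (simp add: h_def not_less top_unique)
  qed
qed

lemma nn_integral_change_of_variables:
  fixes T :: "real ^ 'n::finite \<Rightarrow> real ^ 'n" and f :: "real ^ 'n \<Rightarrow> real"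
  assumes S: "S \<in> sets borel" and TS: "T ` S \<in> sets borel"
    and der: "\<And>x. x \<in> S \<Longrightarrow> (T has_derivative T' x) (at x within S)"
    and inj: "inj_on T S"
    and nonneg: "\<And>y. y \<in> T ` S \<Longrightarrow> 0 \<le> f y"
    and meas: "(\<lambda>y. indicator (T ` S) y * f y) \<in> borel_measurable borel"
      "(\<lambda>x. indicator S x * (\<bar>det (matrix (T' x))\<bar> * f (T x))) \<in> borel_measurable borel"
  shows "(\<integral>\<^sup>+ y. ennreal (f y) * indicator (T ` S) y \<partial>lborel) =
         (\<integral>\<^sup>+ x. ennreal (\<bar>det (matrix (T' x))\<bar> * f (T x)) * indicator S x \<partial>lborel)"
proof -
  define P :: "real ^ 'n \<Rightarrow> real ^ 'n ordered_index" where "P = reindex raw_index"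
  define Q :: "real ^ 'n ordered_index \<Rightarrow> real ^ 'n" where "Q = reindex (inv raw_index)"
  have PQ [simp]: "P (Q y) = y" "Q (P x) = x" for x y
    using reindex_reindex_inv[OF bij_raw_index] by (simp_all add: P_def Q_def)
  have bQ: "bij (inv (raw_index :: 'n ordered_index \<Rightarrow> 'n))" using bij_raw_index bij_imp_bij_inv by blast
  have mQ [measurable]: "Q \<in> borel_measurable borel" by (simp add: Q_def)
  have img: "P ` R = Q -` R" for R by (auto intro: image_eqI[of _ P "Q _"])
  have ind: "indicator (P ` R) y = indicator R (Q y)" for R y by (simp add: img indicator_def)
  have bor: "P ` R \<in> sets borel" if "R \<in> sets borel" for R
    unfolding img using measurable_sets[OF mQ that] by simp
  have nn: "(\<integral>\<^sup>+ y. k (Q y) \<partial>lborel) = (\<integral>\<^sup>+ x. k x \<partial>lborel)" if "k \<in> borel_measurable borel" for k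
    unfolding Q_def by (rule nn_integral_lborel_reindex[OF bQ that])
  define U where "U = P \<circ> T \<circ> Q"
  define U' where "U' y = P \<circ> T' (Q y) \<circ> Q" for y
  have US: "U ` P ` S = P ` T ` S" by (auto simp: U_def image_image)
  have detU: "det (matrix (U' y)) = det (matrix (T' (Q y)))" for y
  proof -
    have iff: "inv raw_index i = j \<longleftrightarrow> i = raw_index j" for i :: 'n and j
      using bij_inv_eq_iff[OF bij_raw_index, of j i] by auto
    have Qax: "Q (axis j 1) = axis (raw_index j) 1" for j
      by (simp add: Q_def reindex_def axis_def iff)
    have "matrix (U' y) = (\<chi> i j. matrix (T' (Q y)) $ raw_index i $ raw_index j)"
      by (simp add: matrix_def U'_def vec_eq_iff Qax P_def reindex_def)
    then show ?thesis using det_reindex[OF bij_raw_index] by simp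
  qed
  have cov: "(\<integral>\<^sup>+ y. ennreal (f (Q y)) * indicator (U ` P ` S) y \<partial>lborel) =
     (\<integral>\<^sup>+ x. ennreal (\<bar>det (matrix (U' x))\<bar> * f (Q (U x))) * indicator (P ` S) x \<partial>lborel)"
  proof (rule nn_integral_change_of_variables_wellorder)
    show "P ` S \<in> sets borel" "U ` P ` S \<in> sets borel" using S TS bor by (auto simp: US)
    show "(U has_derivative U' y) (at y within P ` S)" if "y \<in> P ` S" for y
    proof -
      have QS: "Q ` P ` S = S" by (simp add: image_image)
      have d1: "(Q has_derivative Q) (at y within P ` S)"
        unfolding Q_def by (rule bounded_linear_imp_has_derivative[OF bounded_linear_reindex])
      have d2: "(T has_derivative T' (Q y)) (at (Q y) within Q ` P ` S)"
        unfolding QS using der that by auto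
      have d3: "(P has_derivative P) (at (T (Q y)))"
        unfolding P_def by (rule bounded_linear_imp_has_derivative[OF bounded_linear_reindex])
      from has_derivative_compose[OF diff_chain_within[OF d1 d2, unfolded o_def] d3]
      show ?thesis by (simp add: U_def U'_def o_def)
    qed
    have "P x = P y \<longleftrightarrow> x = y" for x y by (metis PQ(2))
    then show "inj_on U (P ` S)" using inj by (auto simp: inj_on_def U_def)
    show "0 \<le> f (Q y)" if "y \<in> U ` P ` S" for y using nonneg that by (auto simp: US)
    have "(\<lambda>y. indicator (U ` P ` S) y * f (Q y)) = (\<lambda>y. indicator (T ` S) y * f y) \<circ> Q"
      by (simp add: fun_eq_iff US ind)
    then show "(\<lambda>y. indicator (U ` P ` S) y * f (Q y)) \<in> borel_measurable borel"
      using measurable_comp[OF mQ meas(1)] by simp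
    have "(\<lambda>x. indicator (P ` S) x * (\<bar>det (matrix (U' x))\<bar> * f (Q (U x)))) =
       (\<lambda>x. indicator S x * (\<bar>det (matrix (T' x))\<bar> * f (T x))) \<circ> Q"
      by (simp add: fun_eq_iff ind detU U_def)
    then show "(\<lambda>x. indicator (P ` S) x * (\<bar>det (matrix (U' x))\<bar> * f (Q (U x)))) \<in> borel_measurable borel"
      using measurable_comp[OF mQ meas(2)] by simp
  qed
  have e: "ennreal a * indicator R x = ennreal (indicator R x * a)" for a R and x :: "real ^ 'n"
    by (simp add: indicator_def)
  have "(\<integral>\<^sup>+ y. ennreal (f y) * indicator (T ` S) y \<partial>lborel) = (\<integral>\<^sup>+ y. ennreal (f (Q y)) * indicator (T ` S) (Q y) \<partial>lborel)"
    by (rule nn[symmetric]) (use meas(1) in \<open>simp add: e\<close>)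
  also have "\<dots> = (\<integral>\<^sup>+ x. ennreal (\<bar>det (matrix (T' (Q x)))\<bar> * f (T (Q x))) * indicator S (Q x) \<partial>lborel)"
    using cov unfolding US by (simp add: ind detU U_def)
  also have "\<dots> = (\<integral>\<^sup>+ x. ennreal (\<bar>det (matrix (T' x))\<bar> * f (T x)) * indicator S x \<partial>lborel)"
    by (rule nn) (use meas(2) in \<open>simp add: e\<close>)
  finally show ?thesis .
qed

section \<open>The Riemannian volume measure\<close>

text \<open>The segment from the identity to \<open>B\<close> consists of positive definite, hence invertible matrices,
  so the determinant keeps the sign it has at the identity.\<close>

lemma det_pos_if_positive_definite:
  fixes B :: "real ^ 'n::finite ^ 'n"
  assumes pos: "\<And>v. v \<noteq> 0 \<Longrightarrow> v \<bullet> (B *v v) > 0"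
  shows "det B > 0"
proof -
  define C where "C t = (1 - t) *\<^sub>R mat 1 + t *\<^sub>R B" for t :: real
  have nz: "det (C t) \<noteq> 0" if t: "0 \<le> t" "t \<le> 1" for t
  proof
    assume "det (C t) = 0"
    then obtain v where v: "v \<noteq> 0" "C t *v v = 0"
      using invertible_det_nz[of "C t"] invertible_left_inverse[of "C t"] matrix_left_invertible_ker[of "C t"] by blast
    have "v \<bullet> (C t *v v) = (1 - t) * (v \<bullet> v) + t * (v \<bullet> (B *v v))"
      by (simp add: C_def matrix_vector_mult_add_rdistrib scaleR_matrix_vector_assoc[symmetric] inner_add_right)
    moreover have "(1 - t) * (v \<bullet> v) + t * (v \<bullet> (B *v v)) > 0"
    proof (cases "t = 0")
      case False
      then show ?thesis using t pos[OF v(1)] by (intro add_nonneg_pos) auto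
    qed (use v in auto)
    ultimately show False using v(2) by simp
  qed
  have cont: "continuous_on {0..1} (\<lambda>t. det (C t))"
    unfolding det_def C_def by (auto intro!: continuous_intros)
  show ?thesis
  proof (rule ccontr)
    assume "\<not> det B > 0"
    then have "det (C 1) \<le> 0" by (simp add: C_def)
    moreover have "0 \<le> det (C 0)" by (simp add: C_def)
    ultimately obtain t where "0 \<le> t" "t \<le> 1" "det (C t) = 0"
      using IVT2'[of "\<lambda>t. det (C t)" 1 0 0] cont by auto
    then show False using nz by blast
  qed
qed

lemma continuous_on_det:
  fixes G :: "'a::topological_space \<Rightarrow> real ^ 'n::finite ^ 'n"
  assumes "continuous_on S G"
  shows "continuous_on S (\<lambda>y. det (G y))"
  unfolding det_def using assms by (auto intro!: continuous_intros)

locale riemannian_manifold =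
  fixes M :: "'m topology" and A :: "('m, 'n::finite) chart set" and g :: "('m, 'n) tensor2"
  assumes manifold: "smooth_manifold M A" and compact: "compact_space M"
    and metric: "riemannian_metric A g"
begin

definition borelM :: "'m measure" where
  "borelM = sigma (topspace M) {U. openin M U}"

text \<open>The density of the Riemannian volume with respect to Lebesgue measure in the chart \<open>c\<close>.\<close>

definition density_in :: "('m, 'n) chart \<Rightarrow> real ^ 'n \<Rightarrow> real" where
  "density_in c y = sqrt (det (g c (chart_inv c y)))"

lemma space_borelM [simp]: "space borelM = topspace M"
  by (simp add: borelM_def space_measure_of_conv)

lemma sets_borelM: "sets borelM = sigma_sets (topspace M) {U. openin M U}"
  unfolding borelM_def by (rule sets_measure_of) (auto dest: openin_subset)

lemma openin_sets_borelM: "openin M U \<Longrightarrow> U \<in> sets borelM"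
  unfolding sets_borelM by (auto intro: sigma_sets.Basic)

context
  fixes c assumes c: "c \<in> A"
begin

lemma chart: "is_chart M c"
  using manifold c unfolding smooth_manifold_def smooth_atlas_def by blast

lemma open_dom: "openin M (fst c)" and homeo: "homeomorphic_map (subtopology M (fst c)) (top_of_set (chart_image c)) (snd c)"
  and image_open: "open (chart_image c) \<or> openin (top_of_set half_space) (chart_image c)"
  using chart unfolding is_chart_def by auto

lemma dom_subset: "fst c \<subseteq> topspace M"
  using open_dom openin_subset by blast

lemma topspace_Int_dom [simp]: "topspace M \<inter> fst c = fst c"
  using dom_subset by auto

lemma inj_chart: "inj_on (snd c) (fst c)"
  using homeomorphic_imp_injective_map[OF homeo] by simp

lemma chart_inv_chart [simp]: "x \<in> fst c \<Longrightarrow> chart_inv c (snd c x) = x"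
  unfolding chart_inv_def using inj_chart by simp

lemma chart_in [simp]: "x \<in> fst c \<Longrightarrow> snd c x \<in> chart_image c"
  unfolding chart_image_def by simp

lemma chart_chart_inv [simp]: "y \<in> chart_image c \<Longrightarrow> snd c (chart_inv c y) = y"
  unfolding chart_image_def chart_inv_def by (rule f_inv_into_f)

lemma chart_inv_in [simp]: "y \<in> chart_image c \<Longrightarrow> chart_inv c y \<in> fst c"
  unfolding chart_image_def chart_inv_def by (rule inv_into_into)

lemma chart_image_subset: "B \<subseteq> fst c \<Longrightarrow> snd c ` B = {y \<in> chart_image c. chart_inv c y \<in> B}"
proof (intro equalityI subsetI)
  fix y assume B: "B \<subseteq> fst c" "y \<in> {y \<in> chart_image c. chart_inv c y \<in> B}"
  then have "y = snd c (chart_inv c y)" by simp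
  then show "y \<in> snd c ` B" using B by blast
qed auto

lemma borel_half_space: "(half_space :: (real ^ 'n) set) \<in> sets borel"
proof -
  have "(half_space :: (real ^ 'n) set) = (\<lambda>y. y $ normal_index) -` {0..}" by (auto simp: half_space_def)
  moreover have "closed ((\<lambda>y :: real ^ 'n. y $ normal_index) -` {0..})"
    by (rule continuous_closed_vimage) (auto intro!: continuous_intros)
  ultimately show ?thesis by simp
qed

lemma borel_chart_image: "chart_image c \<in> sets borel"
  using image_open borel_half_space by (auto simp: openin_open)

lemma borel_openin_chart_image: "openin (top_of_set (chart_image c)) Y \<Longrightarrow> Y \<in> sets borel"
  using borel_chart_image by (auto simp: openin_open)

lemma chart_inv_measurable: "chart_inv c \<in> restrict_space borel (chart_image c) \<rightarrow>\<^sub>M borelM"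
  unfolding borelM_def
proof (rule measurable_measure_of)
  show "chart_inv c \<in> space (restrict_space borel (chart_image c)) \<rightarrow> topspace M"
    using dom_subset by (auto simp: space_restrict_space)
  fix U assume "U \<in> {U. openin M U}"
  then have "openin (subtopology M (fst c)) (U \<inter> fst c)" by (auto simp: openin_subtopology)
  then have "openin (top_of_set (chart_image c)) (snd c ` (U \<inter> fst c))"
    using homeomorphic_map_openness_eq[OF homeo] by blast
  then have "snd c ` (U \<inter> fst c) \<in> sets borel" by (rule borel_openin_chart_image)
  moreover have "chart_inv c -` U \<inter> chart_image c = snd c ` (U \<inter> fst c)"
    by (subst chart_image_subset) auto
  ultimately show "chart_inv c -` U \<inter> space (restrict_space borel (chart_image c)) \<in> sets (restrict_space borel (chart_image c))"
    using borel_chart_image by (simp add: space_restrict_space sets_restrict_space_iff) blast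
qed (auto dest: openin_subset)

lemma chart_measurable: "snd c \<in> restrict_space borelM (fst c) \<rightarrow>\<^sub>M borel"
proof (rule borel_measurableI)
  fix Y :: "(real ^ 'n) set" assume "open Y"
  then have "openin (top_of_set (chart_image c)) (chart_image c \<inter> Y)" by auto
  then have "openin (subtopology M (fst c)) {x \<in> topspace (subtopology M (fst c)). snd c x \<in> chart_image c \<inter> Y}"
    using openin_continuous_map_preimage[OF homeomorphic_imp_continuous_map[OF homeo]] by blast
  moreover have "{x \<in> topspace (subtopology M (fst c)). snd c x \<in> chart_image c \<inter> Y} = snd c -` Y \<inter> fst c"
    using dom_subset by auto
  ultimately have "openin M (snd c -` Y \<inter> fst c)" using openin_trans_full[OF _ open_dom] by metis
  then show "snd c -` Y \<inter> space (restrict_space borelM (fst c)) \<in> sets (restrict_space borelM (fst c))"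
    using openin_sets_borelM[OF open_dom] openin_sets_borelM dom_subset
    by (subst sets_restrict_space_iff) (auto simp: space_restrict_space Int_absorb1 Int_absorb2)
qed

lemma dom_sets [measurable]: "fst c \<in> sets borelM"
  using openin_sets_borelM[OF open_dom] .

lemma borel_chart_of_sets:
  assumes "B \<in> sets borelM" "B \<subseteq> fst c"
  shows "snd c ` B \<in> sets borel"
proof -
  have "chart_inv c -` B \<inter> space (restrict_space borel (chart_image c)) \<in> sets (restrict_space borel (chart_image c))"
    using measurable_sets[OF chart_inv_measurable assms(1)] .
  moreover have "chart_inv c -` B \<inter> space (restrict_space borel (chart_image c)) = snd c ` B"
    using chart_image_subset[OF assms(2)] by (auto simp: space_restrict_space)
  ultimately show ?thesis using borel_chart_image by (simp add: sets_restrict_space_iff)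
qed

lemma smooth_metric: "smooth_on (chart_image c) (\<lambda>y. g c (chart_inv c y))"
  using metric c unfolding riemannian_metric_def by blast

lemma metric_symmetric: "x \<in> fst c \<Longrightarrow> transpose (g c x) = g c x"
  and metric_pos: "x \<in> fst c \<Longrightarrow> v \<noteq> 0 \<Longrightarrow> v \<bullet> (g c x *v v) > 0"
  using metric c unfolding riemannian_metric_def by blast+

lemma det_metric_pos: "x \<in> fst c \<Longrightarrow> det (g c x) > 0"
  by (rule det_pos_if_positive_definite) (rule metric_pos)

lemma density_in_pos: "y \<in> chart_image c \<Longrightarrow> density_in c y > 0"
  unfolding density_in_def by (simp add: det_metric_pos)

lemma continuous_on_density_in: "continuous_on (chart_image c) (density_in c)"
  unfolding density_in_def
  by (intro continuous_on_real_sqrt continuous_on_det smooth_on_imp_continuous_on smooth_metric)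

lemma density_in_measurable:
  assumes "Y \<in> sets borel" "Y \<subseteq> chart_image c"
  shows "(\<lambda>y. indicator Y y * density_in c y) \<in> borel_measurable borel"
  using borel_measurable_continuous_on_indicator[OF assms(1) continuous_on_subset[OF continuous_on_density_in assms(2)]]
  by simp

text \<open>The candidate for the volume seen by a single chart, as a measure on the whole manifold which is
  concentrated on the coordinate domain.\<close>

definition chart_volume :: "'m measure" where
  "chart_volume = distr (density (restrict_space lborel (chart_image c)) (\<lambda>y. ennreal (density_in c y))) borelM (chart_inv c)"

lemma density_in_measurable_restrict_space:
  "density_in c \<in> borel_measurable (restrict_space lborel (chart_image c))"
  using density_in_measurable[OF borel_chart_image order_refl]
  by (subst borel_measurable_restrict_space_iff) (simp_all add: borel_chart_image)

lemma chart_inv_measurable_density: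
  "chart_inv c \<in> density (restrict_space lborel (chart_image c)) w \<rightarrow>\<^sub>M borelM"
  using chart_inv_measurable by (simp add: measurable_def sets_restrict_space space_restrict_space)

lemma sets_chart_volume [simp]: "sets chart_volume = sets borelM"
  and space_chart_volume [simp]: "space chart_volume = topspace M"
  by (simp_all add: chart_volume_def)

lemma emeasure_chart_volume:
  assumes B: "B \<in> sets borelM"
  shows "emeasure chart_volume B = (\<integral>\<^sup>+ y\<in>snd c ` (B \<inter> fst c). ennreal (density_in c y) \<partial>lborel)"
proof -
  let ?R = "restrict_space lborel (chart_image c)"
  have pre: "chart_inv c -` B \<inter> chart_image c \<in> sets ?R"
    using measurable_sets[OF chart_inv_measurable B] by (simp add: sets_restrict_space space_restrict_space)
  have "emeasure chart_volume B = (\<integral>\<^sup>+ y. ennreal (density_in c y) * indicator (chart_inv c -` B \<inter> chart_image c) y \<partial>?R)"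
  proof -
    have "emeasure chart_volume B = emeasure (density ?R (\<lambda>y. ennreal (density_in c y))) (chart_inv c -` B \<inter> chart_image c)"
      unfolding chart_volume_def
      by (subst emeasure_distr[OF chart_inv_measurable_density B]) (simp add: space_restrict_space)
    also have "\<dots> = (\<integral>\<^sup>+ y. ennreal (density_in c y) * indicator (chart_inv c -` B \<inter> chart_image c) y \<partial>?R)"
      by (rule emeasure_density) (use density_in_measurable_restrict_space pre in auto)
    finally show ?thesis .
  qed
  also have "\<dots> = (\<integral>\<^sup>+ y. ennreal (density_in c y) * indicator (chart_inv c -` B \<inter> chart_image c) y * indicator (chart_image c) y \<partial>lborel)"
    by (rule nn_integral_restrict_space) (simp add: borel_chart_image)
  also have "\<dots> = (\<integral>\<^sup>+ y\<in>snd c ` (B \<inter> fst c). ennreal (density_in c y) \<partial>lborel)"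
    by (rule nn_integral_cong) (auto simp: chart_image_subset indicator_def)
  finally show ?thesis .
qed

end

text \<open>The Jacobian in the transformation law of the metric is the derivative within the overlap that
  the choice operator picks; the change of variables formula accepts any such derivative.\<close>

lemma metric_transform:
  assumes "c \<in> A" "d \<in> A" "x \<in> fst c" "x \<in> fst d"
  shows "\<exists>D. (transition c d has_derivative D) (at (snd c x) within snd c ` (fst c \<inter> fst d)) \<and>
    density_in c (snd c x) = \<bar>det (matrix D)\<bar> * density_in d (snd d x)"
proof -
  let ?R = "snd c ` (fst c \<inter> fst d)"
  let ?D = "frechet_derivative (transition c d) (at (snd c x) within ?R)"
  have "smooth_on ?R (transition c d)"
    using manifold assms(1,2) unfolding smooth_manifold_def smooth_atlas_def by blast
  then have "transition c d differentiable (at (snd c x) within ?R)"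
    by (rule smooth_on_differentiable_within) (use assms in auto)
  then have D: "(transition c d has_derivative ?D) (at (snd c x) within ?R)"
    by (simp add: frechet_derivative_works)
  have "g c x = transpose (matrix ?D) ** g d x ** matrix ?D"
    using metric assms unfolding riemannian_metric_def jacobian_def Let_def by blast
  then have "det (g c x) = (det (matrix ?D))\<^sup>2 * det (g d x)"
    by (simp add: det_mul det_transpose power2_eq_square)
  then have "density_in c (snd c x) = \<bar>det (matrix ?D)\<bar> * density_in d (snd d x)"
    using assms by (simp add: density_in_def real_sqrt_mult)
  with D show ?thesis by blast
qed

text \<open>The densities of two charts define the same measure on the overlap, by change of variables.\<close>

lemma density_integral_chart_independent:
  assumes c: "c \<in> A" and d: "d \<in> A" and B: "B \<in> sets borelM" "B \<subseteq> fst c" "B \<subseteq> fst d"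
  shows "(\<integral>\<^sup>+ y\<in>snd c ` B. ennreal (density_in c y) \<partial>lborel) = (\<integral>\<^sup>+ y\<in>snd d ` B. ennreal (density_in d y) \<partial>lborel)"
proof -
  define T where "T = transition c d"
  have "\<forall>y\<in>snd c ` B. \<exists>D. (T has_derivative D) (at y within snd c ` (fst c \<inter> fst d)) \<and>
      density_in c y = \<bar>det (matrix D)\<bar> * density_in d (T y)"
  proof (rule ballI, elim imageE)
    fix y x assume y: "y = snd c x" and "x \<in> B"
    then have x: "x \<in> fst c" "x \<in> fst d" using B by auto
    show "\<exists>D. (T has_derivative D) (at y within snd c ` (fst c \<inter> fst d)) \<and>
      density_in c y = \<bar>det (matrix D)\<bar> * density_in d (T y)"
      using metric_transform[OF c d x] c x unfolding y by (simp add: T_def transition_def)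
  qed
  then obtain D where D: "\<And>y. y \<in> snd c ` B \<Longrightarrow> (T has_derivative D y) (at y within snd c ` (fst c \<inter> fst d))"
      "\<And>y. y \<in> snd c ` B \<Longrightarrow> density_in c y = \<bar>det (matrix (D y))\<bar> * density_in d (T y)"
    by metis
  have Tc: "T (snd c x) = snd d x" if "x \<in> B" for x using that B c by (auto simp: T_def transition_def)
  have TB: "T ` snd c ` B = snd d ` B" using Tc by (force simp: image_image)
  have "(\<integral>\<^sup>+ y. ennreal (density_in d y) * indicator (T ` snd c ` B) y \<partial>lborel) =
    (\<integral>\<^sup>+ y. ennreal (\<bar>det (matrix (D y))\<bar> * density_in d (T y)) * indicator (snd c ` B) y \<partial>lborel)"
  proof (rule nn_integral_change_of_variables)
    show "snd c ` B \<in> sets borel" "T ` snd c ` B \<in> sets borel"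
      unfolding TB using borel_chart_of_sets c d B by auto
    show "(T has_derivative D y) (at y within snd c ` B)" if "y \<in> snd c ` B" for y
      by (rule has_derivative_subset[OF D(1)[OF that]]) (use B in auto)
    show "inj_on T (snd c ` B)"
      using Tc inj_on_subset[OF inj_chart[OF d] B(3)] by (auto simp: inj_on_def)
    show "0 \<le> density_in d y" if "y \<in> T ` snd c ` B" for y
      using density_in_pos[OF d, of y] that B d unfolding TB by force
    show "(\<lambda>y. indicator (T ` snd c ` B) y * density_in d y) \<in> borel_measurable borel"
      unfolding TB by (rule density_in_measurable[OF d]) (use B borel_chart_of_sets[OF d] d in auto)
    have "(\<lambda>y. indicator (snd c ` B) y * (\<bar>det (matrix (D y))\<bar> * density_in d (T y))) =
       (\<lambda>y. indicator (snd c ` B) y * density_in c y)"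
      using D(2) by (auto simp: fun_eq_iff indicator_def)
    moreover have "(\<lambda>y. indicator (snd c ` B) y * density_in c y) \<in> borel_measurable borel"
      by (rule density_in_measurable[OF c]) (use B borel_chart_of_sets[OF c] c in auto)
    ultimately show "(\<lambda>y. indicator (snd c ` B) y * (\<bar>det (matrix (D y))\<bar> * density_in d (T y))) \<in> borel_measurable borel"
      by simp
  qed
  also have "\<dots> = (\<integral>\<^sup>+ y\<in>snd c ` B. ennreal (density_in c y) \<partial>lborel)"
    by (rule nn_integral_cong) (auto simp: indicator_def D(2))
  finally show ?thesis by (simp add: TB)
qed

text \<open>A finite subatlas exists by compactness; subtracting from each domain the preceding ones makes
  the pieces disjoint.\<close>

lemma finite_disjoint_cover:
  obtains I :: "nat set" and C :: "nat \<Rightarrow> ('m, 'n) chart" and P :: "nat \<Rightarrow> 'm set" where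
    "finite I" "\<And>k. k \<in> I \<Longrightarrow> C k \<in> A" "\<And>k. k \<in> I \<Longrightarrow> P k \<in> sets borelM" "\<And>k. k \<in> I \<Longrightarrow> P k \<subseteq> fst (C k)"
    "disjoint_family_on P I" "(\<Union>k\<in>I. P k) = topspace M"
proof -
  have cov: "(\<Union>c\<in>A. fst c) = topspace M"
    using manifold unfolding smooth_manifold_def smooth_atlas_def by blast
  have "\<exists>\<F>. finite \<F> \<and> \<F> \<subseteq> fst ` A \<and> topspace M \<subseteq> \<Union>\<F>"
    using compact unfolding compact_space_alt using cov open_dom by auto
  then obtain \<F> where "finite \<F>" "\<F> \<subseteq> fst ` A" and top: "topspace M \<subseteq> \<Union>\<F>" by blast
  then obtain F where F': "F \<subseteq> A" "finite F" "\<F> = fst ` F" using finite_subset_image by metis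
  then have F: "finite F" "F \<subseteq> A" "topspace M \<subseteq> \<Union>(fst ` F)" using top by simp_all
  obtain n and C :: "nat \<Rightarrow> ('m, 'n) chart" where C: "F = C ` {i. i < n}"
    using finite_imp_nat_seg_image_inj_on[OF F(1)] by blast
  define P where "P k = fst (C k) - (\<Union>i<k. fst (C i))" for k
  have CA: "C k \<in> A" if "k < n" for k using F(2) C that by auto
  show thesis
  proof (rule that[of "{..<n}" C P])
    show "P k \<in> sets borelM" if "k \<in> {..<n}" for k
      unfolding P_def using that by (intro sets.Diff sets.finite_UN dom_sets CA) auto
    show "disjoint_family_on P {..<n}"
      unfolding disjoint_family_on_def P_def
    proof (intro ballI impI)
      fix i j :: nat assume "i \<noteq> j"
      then show "(fst (C i) - (\<Union>k<i. fst (C k))) \<inter> (fst (C j) - (\<Union>k<j. fst (C k))) = {}"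
        by (cases i j rule: linorder_cases) auto
    qed
    show "(\<Union>k\<in>{..<n}. P k) = topspace M"
    proof
      show "(\<Union>k\<in>{..<n}. P k) \<subseteq> topspace M" using dom_subset[OF CA] by (force simp: P_def)
      show "topspace M \<subseteq> (\<Union>k\<in>{..<n}. P k)"
      proof
        fix x assume "x \<in> topspace M"
        then have ex: "\<exists>k. k < n \<and> x \<in> fst (C k)" using F(3) C by auto
        define k where "k = (LEAST k. k < n \<and> x \<in> fst (C k))"
        have "k < n \<and> x \<in> fst (C k)" unfolding k_def by (rule LeastI_ex[OF ex])
        moreover have "x \<notin> fst (C i)" if "i < k" for i
          using not_less_Least[of i "\<lambda>k. k < n \<and> x \<in> fst (C k)"] that calculation by (auto simp: k_def)
        ultimately show "x \<in> (\<Union>k\<in>{..<n}. P k)" by (auto simp: P_def)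
      qed
    qed
  qed (auto simp: CA P_def)
qed

text \<open>The sum of the chart measures, each restricted to its piece of a finite partition, has the right
  value on every chart because the densities agree on overlaps. Conversely the defining property
  fixes the measure on each piece, hence everywhere.\<close>

lemma ex1_volume: "\<exists>!V. is_riemannian_volume M A g V"
proof -
  obtain I :: "nat set" and C :: "nat \<Rightarrow> ('m, 'n) chart" and P where
    I: "finite I" and C: "\<And>k. k \<in> I \<Longrightarrow> C k \<in> A" and P: "\<And>k. k \<in> I \<Longrightarrow> P k \<in> sets borelM" "\<And>k. k \<in> I \<Longrightarrow> P k \<subseteq> fst (C k)"
    and disj: "disjoint_family_on P I" and UN: "(\<Union>k\<in>I. P k) = topspace M"
    using finite_disjoint_cover by metis
  define m where "m B = (\<Sum>k\<in>I. emeasure (chart_volume (C k)) (B \<inter> P k))" for B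
  define V where "V = measure_of (topspace M) (sets borelM) m"
  have sub: "sets borelM \<subseteq> Pow (topspace M)" using sets.space_closed[of borelM] by simp
  have sigma: "sigma_sets (topspace M) (sets borelM) = sets borelM"
    using sets.sigma_sets_eq[of borelM] by simp
  have sets_V: "sets V = sets borelM" unfolding V_def by (simp add: sets_measure_of[OF sub] sigma)
  have space_V: "space V = topspace M" unfolding V_def by (simp add: space_measure_of[OF sub])
  have V: "emeasure V B = m B" if B: "B \<in> sets borelM" for B
  proof (rule emeasure_measure_of[OF V_def sub _ _ ])
    show "positive (sets V) m" by (simp add: positive_def m_def)
    show "countably_additive (sets V) m"
    proof (rule countably_additiveI)
      fix B :: "nat \<Rightarrow> 'm set" assume B: "range B \<subseteq> sets V" "disjoint_family B" "\<Union>(range B) \<in> sets V"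
      have "(\<Sum>i. m (B i)) = (\<Sum>k\<in>I. \<Sum>i. emeasure (chart_volume (C k)) (B i \<inter> P k))"
        unfolding m_def by (rule suminf_sum) auto
      also have "\<dots> = (\<Sum>k\<in>I. emeasure (chart_volume (C k)) (\<Union>(range B) \<inter> P k))"
      proof (rule sum.cong[OF refl])
        fix k assume k: "k \<in> I"
        have "(\<Sum>i. emeasure (chart_volume (C k)) (B i \<inter> P k)) = emeasure (chart_volume (C k)) (\<Union>i. B i \<inter> P k)"
          by (rule suminf_emeasure) (use B P(1)[OF k] C[OF k] in \<open>auto simp: sets_V disjoint_family_on_def\<close>)
        then show "(\<Sum>i. emeasure (chart_volume (C k)) (B i \<inter> P k)) = emeasure (chart_volume (C k)) (\<Union>(range B) \<inter> P k)"
          by (simp add: Int_UN_distrib2)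
      qed
      finally show "(\<Sum>i. m (B i)) = m (\<Union>(range B))" by (simp add: m_def)
    qed
    show "B \<in> sets V" using B by (simp add: sets_V)
  qed
  have part: "(\<Sum>k\<in>I. emeasure N (B \<inter> P k)) = emeasure N B" if N: "sets N = sets borelM" "B \<in> sets borelM" for N B
  proof -
    have "(\<Sum>k\<in>I. emeasure N (B \<inter> P k)) = emeasure N (\<Union>k\<in>I. B \<inter> P k)"
    proof (rule sum_emeasure)
      show "disjoint_family_on (\<lambda>k. B \<inter> P k) I" using disj unfolding disjoint_family_on_def by blast
    qed (use N P(1) I in auto)
    moreover have "(\<Union>k\<in>I. B \<inter> P k) = B" using UN sub N(2) by blast
    ultimately show ?thesis by simp
  qed
  have "is_riemannian_volume M A g V"
    unfolding is_riemannian_volume_def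
  proof (intro conjI ballI impI)
    fix c B assume c: "c \<in> A" and "B \<in> sets V" and Bc: "B \<subseteq> fst c"
    then have B: "B \<in> sets borelM" by (simp add: sets_V)
    have "emeasure V B = (\<Sum>k\<in>I. emeasure (chart_volume c) (B \<inter> P k))"
      unfolding V[OF B] m_def
    proof (rule sum.cong[OF refl])
      fix k assume k: "k \<in> I"
      have eq: "B \<inter> P k \<inter> fst (C k) = B \<inter> P k" "B \<inter> P k \<inter> fst c = B \<inter> P k" using P(2)[OF k] Bc by auto
      show "emeasure (chart_volume (C k)) (B \<inter> P k) = emeasure (chart_volume c) (B \<inter> P k)"
        using density_integral_chart_independent[OF C[OF k] c, of "B \<inter> P k"] B P[OF k] C[OF k] c Bc
        by (simp add: emeasure_chart_volume eq le_infI1 le_infI2 sets.Int)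
    qed
    also have "\<dots> = emeasure (chart_volume c) B" by (rule part) (use B c in auto)
    also have "\<dots> = (\<integral>\<^sup>+ y\<in>snd c ` B. ennreal (density_in c y) \<partial>lborel)"
      using emeasure_chart_volume[OF c B] Bc by (simp add: Int_absorb2)
    finally show "emeasure V B = (\<integral>\<^sup>+ y\<in>snd c ` B. ennreal (sqrt (det (g c (chart_inv c y)))) \<partial>lborel)"
      by (simp add: density_in_def)
  qed (use sets_V space_V sets_borelM in auto)
  moreover have "W = V'" if W: "is_riemannian_volume M A g W" and V': "is_riemannian_volume M A g V'" for W V'
  proof (rule measure_eqI)
    have s: "sets W = sets borelM" "sets V' = sets borelM"
      using W V' by (simp_all add: is_riemannian_volume_def sets_borelM)
    show "sets W = sets V'" using s by simp
    fix B assume "B \<in> sets W"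
    then have B: "B \<in> sets borelM" using s by simp
    have "emeasure W (B \<inter> P k) = emeasure V' (B \<inter> P k)" if k: "k \<in> I" for k
    proof -
      have "B \<inter> P k \<in> sets borelM" "B \<inter> P k \<subseteq> fst (C k)" using B P[OF k] by auto
      then show ?thesis using W V' C[OF k] s by (simp add: is_riemannian_volume_def)
    qed
    then show "emeasure W B = emeasure V' B" using part[OF s(1) B] part[OF s(2) B] by simp
  qed
  ultimately show ?thesis by blast
qed

definition V :: "'m measure" where "V = riemannian_volume M A g"

lemma volume: "is_riemannian_volume M A g V"
  unfolding V_def riemannian_volume_def by (rule theI'[OF ex1_volume])

lemma space_V [simp]: "space V = topspace M" and sets_V [simp]: "sets V = sets borelM"
  using volume by (simp_all add: is_riemannian_volume_def sets_borelM)

lemma restrict_volume: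
  assumes c: "c \<in> A"
  shows "restrict_space V (fst c) = restrict_space (chart_volume c) (fst c)"
proof (rule measure_eqI)
  show "sets (restrict_space V (fst c)) = sets (restrict_space (chart_volume c) (fst c))"
    using c by (simp add: sets_restrict_space)
  fix B assume "B \<in> sets (restrict_space V (fst c))"
  then have B: "B \<in> sets borelM" "B \<subseteq> fst c"
    using dom_sets[OF c] by (simp_all add: sets_restrict_space_iff Int_absorb2[OF dom_subset[OF c]])
  have "emeasure V B = emeasure (chart_volume c) B"
    using volume c B emeasure_chart_volume[OF c B(1)]
    by (simp add: is_riemannian_volume_def density_in_def Int_absorb2)
  then show "emeasure (restrict_space V (fst c)) B = emeasure (restrict_space (chart_volume c) (fst c)) B"
    using B c dom_sets[OF c] dom_subset[OF c] by (simp add: emeasure_restrict_space Int_absorb2)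
qed

text \<open>Integrals over the manifold of functions supported in one chart are Lebesgue integrals.\<close>

lemma integral_volume_chart:
  fixes h :: "'m \<Rightarrow> real"
  assumes c: "c \<in> A" and h: "h \<in> borel_measurable borelM" and zero: "\<And>x. x \<in> topspace M - fst c \<Longrightarrow> h x = 0"
  shows "(LINT x|V. h x) = (LINT y|lborel. indicator (chart_image c) y * (density_in c y * h (chart_inv c y)))"
    and "integrable V h \<longleftrightarrow> integrable lborel (\<lambda>y. indicator (chart_image c) y * (density_in c y * h (chart_inv c y)))"
proof -
  let ?R = "restrict_space lborel (chart_image c)"
  let ?D = "density ?R (\<lambda>y. ennreal (density_in c y))"
  have ind: "h x = indicator (fst c) x *\<^sub>R h x" if "x \<in> topspace M" for x
    using zero[of x] that by (auto simp: indicator_def)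
  have dom: "fst c \<inter> topspace M = fst c" using dom_subset[OF c] by auto
  have cs: "fst c \<inter> space V \<in> sets V" "fst c \<inter> space (chart_volume c) \<in> sets (chart_volume c)"
    using dom_sets[OF c] c dom by auto
  have hi: "(\<lambda>y. h (chart_inv c y)) \<in> borel_measurable ?D"
    using measurable_compose[OF chart_inv_measurable_density[OF c] h] .
  have hi': "(\<lambda>y. h (chart_inv c y)) \<in> borel_measurable ?R" using hi by simp
  have w0: "AE y in ?R. 0 \<le> density_in c y"
    using density_in_pos[OF c] by (intro AE_I2) (auto simp: space_restrict_space intro: less_imp_le)
  have bor: "chart_image c \<inter> space lborel \<in> sets lborel" using borel_chart_image[OF c] by simp
  have z: "(LINT x|N. h x) = (LINT x|restrict_space N (fst c). h x)"
      "integrable N h \<longleftrightarrow> integrable (restrict_space N (fst c)) h"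
    if N: "space N = topspace M" "sets N = sets borelM" for N
  proof -
    have fc: "fst c \<inter> space N \<in> sets N" using N dom dom_sets[OF c] by simp
    show "(LINT x|N. h x) = (LINT x|restrict_space N (fst c). h x)"
      unfolding integral_restrict_space[OF fc] by (rule Bochner_Integration.integral_cong) (use ind N in auto)
    show "integrable N h \<longleftrightarrow> integrable (restrict_space N (fst c)) h"
      unfolding integrable_restrict_space[OF fc] set_integrable_def
      by (rule Bochner_Integration.integrable_cong) (use ind N in auto)
  qed
  have "(LINT x|V. h x) = (LINT x|chart_volume c. h x)"
    using z[of V] z[of "chart_volume c"] restrict_volume[OF c] c by simp
  also have "\<dots> = (LINT y|?D. h (chart_inv c y))"
    unfolding chart_volume_def[OF c] by (rule integral_distr[OF chart_inv_measurable_density[OF c] h])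
  also have "\<dots> = (LINT y|?R. density_in c y *\<^sub>R h (chart_inv c y))"
    by (rule integral_density[OF hi' density_in_measurable_restrict_space[OF c] w0])
  also have "\<dots> = (LINT y|lborel. indicator (chart_image c) y *\<^sub>R (density_in c y *\<^sub>R h (chart_inv c y)))"
    by (rule integral_restrict_space[OF bor])
  finally show "(LINT x|V. h x) = (LINT y|lborel. indicator (chart_image c) y * (density_in c y * h (chart_inv c y)))"
    by simp
  have "integrable V h \<longleftrightarrow> integrable (chart_volume c) h"
    using z[of V] z[of "chart_volume c"] restrict_volume[OF c] c by simp
  also have "\<dots> \<longleftrightarrow> integrable ?D (\<lambda>y. h (chart_inv c y))"
    unfolding chart_volume_def[OF c] by (rule integrable_distr_eq[OF chart_inv_measurable_density[OF c] h])
  also have "\<dots> \<longleftrightarrow> integrable ?R (\<lambda>y. density_in c y *\<^sub>R h (chart_inv c y))"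
    by (rule integrable_density[OF hi' density_in_measurable_restrict_space[OF c] w0])
  also have "\<dots> \<longleftrightarrow> integrable lborel (\<lambda>y. indicator (chart_image c) y *\<^sub>R (density_in c y *\<^sub>R h (chart_inv c y)))"
    using integrable_restrict_space[OF bor, of "\<lambda>y. density_in c y *\<^sub>R h (chart_inv c y)"]
    by (simp only: set_integrable_def)
  finally show "integrable V h \<longleftrightarrow> integrable lborel (\<lambda>y. indicator (chart_image c) y * (density_in c y * h (chart_inv c y)))"
    by simp
qed

end

section \<open>Frequencies and squared eigenfunctions from the local Weyl function\<close>

text \<open>Induction along the frequencies: given agreement below \<open>j\<close>, a strictly smaller \<open>j\<close>-th frequency
  on one side would make the counting functions differ there by the square of an eigenfunction that
  is not identically zero. Only the values at the frequencies are used; each sums finitely many terms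
  since \<open>lam\<close> is strictly increasing.\<close>

lemma local_weyl_determines_frequencies_and_squares:
  fixes lam lam' :: "nat \<Rightarrow> real" and e e' :: "nat \<Rightarrow> 'm \<Rightarrow> real"
  assumes lam: "strict_mono lam" and lam': "strict_mono lam'"
    and nz: "\<And>j. \<exists>x\<in>X. e j x \<noteq> 0" and nz': "\<And>j. \<exists>x\<in>X. e' j x \<noteq> 0"
    and eq: "\<And>x l. x \<in> X \<Longrightarrow> local_weyl lam e x l = local_weyl lam' e' x l"
  shows "lam j = lam' j \<and> (\<forall>x\<in>X. (e j x)\<^sup>2 = (e' j x)\<^sup>2)"
proof (induction j rule: less_induct)
  case (less j)
  have at: "local_weyl l f x (l j) = (\<Sum>i<j. (f i x)\<^sup>2) + (f j x)\<^sup>2" if "strict_mono l" for l and f :: "nat \<Rightarrow> 'm \<Rightarrow> real" and x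
  proof -
    have "{i. l i \<le> l j} = insert j {..<j}" using that by (auto simp: strict_mono_less_eq)
    then show ?thesis by (simp add: local_weyl_def)
  qed
  have below: "\<not> l j < l' j"
    if l: "strict_mono l" "strict_mono l'" and ne: "\<exists>x\<in>X. f j x \<noteq> 0"
      and IH: "\<And>i. i < j \<Longrightarrow> l i = l' i \<and> (\<forall>x\<in>X. (f i x)\<^sup>2 = (f' i x)\<^sup>2)"
      and weyl: "\<And>x t. x \<in> X \<Longrightarrow> local_weyl l f x t = local_weyl l' f' x t"
    for l l' and f f' :: "nat \<Rightarrow> 'm \<Rightarrow> real"
  proof
    assume lt: "l j < l' j"
    have "l' i \<le> l j \<longleftrightarrow> i < j" for i
    proof (cases "i < j")
      case True
      then show ?thesis using IH[OF True] strict_monoD[OF l(1) True] by simp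
    next
      case False
      then have "l' j \<le> l' i" using l(2) by (simp add: strict_mono_less_eq)
      then show ?thesis using lt False by simp
    qed
    then have "{i. l' i \<le> l j} = {..<j}" by auto
    then have "local_weyl l' f' x (l j) = (\<Sum>i<j. (f i x)\<^sup>2)" if "x \<in> X" for x
      using IH that by (simp add: local_weyl_def)
    then have "f j x = 0" if "x \<in> X" for x using at[OF l(1), of f x] weyl[OF that, of "l j"] that by simp
    with ne show False by blast
  qed
  have "\<not> lam j < lam' j" by (rule below[OF lam lam' nz less eq])
  moreover have "\<not> lam' j < lam j"
    by (rule below[of lam' lam e' e, OF lam' lam nz']) (use less eq in auto)
  ultimately have lj: "lam j = lam' j" by simp
  moreover have "(e j x)\<^sup>2 = (e' j x)\<^sup>2" if x: "x \<in> X" for x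
  proof -
    have "(\<Sum>i<j. (e i x)\<^sup>2) = (\<Sum>i<j. (e' i x)\<^sup>2)" using less x by simp
    then show ?thesis using at[OF lam, of e x] at[OF lam', of e' x] eq[OF x, of "lam j"] lj by simp
  qed
  ultimately show ?case by blast
qed

lemma orthonormal_nonzero:
  assumes "L2_orthonormal_basis V e"
  shows "\<exists>x\<in>space V. e j x \<noteq> 0"
proof (rule ccontr)
  assume "\<not> ?thesis"
  then have "L2_inner V (e j) (e j) = (LINT x|V. 0)"
    unfolding L2_inner_def by (intro Bochner_Integration.integral_cong) auto
  then show False using assms by (simp add: L2_orthonormal_basis_def)
qed

text \<open>Two basis functions with the same frequency would be multiples of one function, contradicting
  orthonormality.\<close>

lemma simple_spectrum_strict_mono:
  assumes simple: "simple_spectrum bc M A g" and basis: "laplace_eigenbasis bc M A g lam e"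
    and sp: "space (riemannian_volume M A g) = topspace M"
  shows "strict_mono lam"
proof -
  let ?V = "riemannian_volume M A g"
  have on: "L2_orthonormal_basis ?V e" and mono: "incseq lam" and eig: "\<And>j. e j \<in> laplace_eigenspace bc A g ((lam j)\<^sup>2)"
    using basis by (auto simp: laplace_eigenbasis_def)
  have "lam i \<noteq> lam j" if "i < j" for i j
  proof
    assume eq: "lam i = lam j"
    obtain u where u: "\<And>v. v \<in> laplace_eigenspace bc A g ((lam j)\<^sup>2) \<Longrightarrow> \<exists>a. \<forall>x\<in>topspace M. v x = a * u x"
      using simple eig[of j] orthonormal_nonzero[OF on, of j] unfolding simple_spectrum_def sp by blast
    obtain a b where ab: "\<And>x. x \<in> topspace M \<Longrightarrow> e i x = a * u x" "\<And>x. x \<in> topspace M \<Longrightarrow> e j x = b * u x"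
      using u[OF eig[of j]] u[of "e i"] eig[of i] eq by metis
    have inner: "L2_inner ?V f h = s * t * (LINT x|?V. (u x)\<^sup>2)"
      if "\<And>x. x \<in> topspace M \<Longrightarrow> f x = s * u x" "\<And>x. x \<in> topspace M \<Longrightarrow> h x = t * u x" for f h s t
    proof -
      have "L2_inner ?V f h = (LINT x|?V. (s * t) * (u x)\<^sup>2)"
        unfolding L2_inner_def
        by (rule Bochner_Integration.integral_cong) (simp_all add: sp that power2_eq_square)
      then show ?thesis by simp
    qed
    have "a * b * (LINT x|?V. (u x)\<^sup>2) = 0" "a * a * (LINT x|?V. (u x)\<^sup>2) = 1" "b * b * (LINT x|?V. (u x)\<^sup>2) = 1"
      using inner[OF ab] inner[OF ab(1) ab(1)] inner[OF ab(2) ab(2)] on that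
      by (simp_all add: L2_orthonormal_basis_def)
    then show False by auto
  qed
  then show ?thesis using mono by (intro strict_monoI) (metis incseq_def less_imp_le order_le_less)
qed

lemma orthogonal_to_basis_imp_null:
  assumes "L2_orthonormal_basis V e" "h \<in> L2 V" "\<And>j. L2_inner V h (e j) = 0"
  shows "(LINT x|V. (h x)\<^sup>2) = 0"
proof -
  have "(\<lambda>n. LINT x|V. (h x - (\<Sum>j<n. L2_inner V h (e j) * e j x))\<^sup>2) \<longlonglongrightarrow> 0"
    using assms(1,2) by (auto simp: L2_orthonormal_basis_def)
  then show ?thesis using assms(3) by (simp add: LIMSEQ_const_iff)
qed

section \<open>Null integrals, inverse matrices and half-space domains\<close>

lemma continuous_zero_of_integral_zero:
  fixes f :: "'a::euclidean_space \<Rightarrow> real"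
  assumes U: "open U" and cont: "continuous_on U f" and nonneg: "\<And>y. y \<in> U \<Longrightarrow> 0 \<le> f y"
    and int: "integrable lborel (\<lambda>y. indicator U y * f y)" and zero: "(\<integral>y. indicator U y * f y \<partial>lborel) = 0"
    and y: "y \<in> U"
  shows "f y = 0"
proof (rule ccontr)
  assume "f y \<noteq> 0"
  define N where "N = U \<inter> f -` (- {0})"
  have N: "open N" "y \<in> N"
    using continuous_open_preimage[OF cont U, of "- {0}"] y \<open>f y \<noteq> 0\<close> by (auto simp: N_def)
  have "AE y in lborel. indicator U y * f y = 0"
    using integral_nonneg_eq_0_iff_AE[OF int] zero nonneg by (auto simp: indicator_def)
  then have "AE y in lborel. y \<notin> N" by (rule AE_mp) (auto simp: N_def indicator_def)
  then have "N \<in> null_sets lborel" using AE_iff_null_sets[of N lborel] N(1) by simp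
  then have "negligible N" using null_sets_completionI negligible_iff_null_sets by blast
  then show False using open_not_negligible[OF N(1)] N(2) by blast
qed

lemma invertible_if_det_pos: "det (B :: real ^ 'n::finite ^ 'n) > 0 \<Longrightarrow> invertible B"
  by (simp add: invertible_det_nz)

lemma matrix_inv_mult:
  assumes "invertible B"
  shows "B ** matrix_inv B = mat 1" "matrix_inv B ** B = mat 1"
  using someI_ex[OF assms[unfolded invertible_def]] by (simp_all add: matrix_inv_def)

lemma transpose_matrix_inv:
  fixes B :: "real ^ 'n::finite ^ 'n"
  assumes B: "invertible B" "transpose B = B"
  shows "transpose (matrix_inv B) = matrix_inv B"
proof -
  have "transpose (matrix_inv B) ** B = transpose (B ** matrix_inv B)"
    using B(2) by (simp add: matrix_transpose_mul)
  then have "transpose (matrix_inv B) ** B = mat 1" using B(1) by (simp add: matrix_inv_mult transpose_mat)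
  then have "transpose (matrix_inv B) ** B ** matrix_inv B = matrix_inv B" by simp
  then show ?thesis using B(1) by (simp add: matrix_mul_assoc[symmetric] matrix_inv_mult)
qed

lemma matrix_inv_injective:
  fixes B C :: "real ^ 'n::finite ^ 'n"
  assumes "invertible B" "invertible C" "matrix_inv B = matrix_inv C"
  shows "B = C"
proof -
  have "B = B ** (matrix_inv C ** C)" using assms(2) by (simp add: matrix_inv_mult)
  also have "\<dots> = (B ** matrix_inv B) ** C" using assms(3) by (simp add: matrix_mul_assoc)
  also have "\<dots> = C" using assms(1) by (simp add: matrix_inv_mult)
  finally show ?thesis .
qed

lemma Ck_on_det:
  fixes G :: "'a::euclidean_space \<Rightarrow> real ^ 'n::finite ^ 'n"
  assumes "open U" "\<And>i j. Ck_on k U (\<lambda>z. G z $ i $ j)"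
  shows "Ck_on k U (\<lambda>z. det (G z))"
  unfolding det_def by (intro Ck_on_sum Ck_on_mult Ck_on_const Ck_on_prod assms)

text \<open>By Cramer's rule the entries of the inverse are quotients of determinants.\<close>

lemma Ck_on_matrix_inv:
  fixes G :: "'a::euclidean_space \<Rightarrow> real ^ 'n::finite ^ 'n"
  assumes U: "open U" and G: "\<And>i j. Ck_on k U (\<lambda>z. G z $ i $ j)" and det: "\<And>z. z \<in> U \<Longrightarrow> det (G z) \<noteq> 0"
  shows "Ck_on k U (\<lambda>z. matrix_inv (G z) $ r $ s)"
proof -
  define C where "C z = (\<chi> i j. if j = r then axis s 1 $ i else G z $ i $ j)" for z
  have quot: "Ck_on k U (\<lambda>z. det (C z) / det (G z))"
  proof (intro Ck_on_divide Ck_on_det U G det)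
    show "Ck_on k U (\<lambda>z. C z $ i $ j)" for i j
      using G Ck_on_const by (cases "j = r") (auto simp: C_def)
  qed
  have "det (C z) / det (G z) = matrix_inv (G z) $ r $ s" if "z \<in> U" for z
  proof -
    have "G z *v (matrix_inv (G z) *v axis s 1) = axis s 1"
      using matrix_inv_mult(1)[of "G z"] det[OF that]
      by (simp add: matrix_vector_mul_assoc invertible_det_nz)
    then have "matrix_inv (G z) *v axis s 1 = (\<chi> r. det (\<chi> i j. if j = r then axis s 1 $ i else G z $ i $ j) / det (G z))"
      using cramer[OF det[OF that]] by blast
    then have "(matrix_inv (G z) *v axis s 1) $ r = det (C z) / det (G z)" by (simp add: C_def)
    then show ?thesis by (simp add: matrix_vector_mult_basis column_def)
  qed
  then show ?thesis by (rule Ck_on_cong[OF U _ quot])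
qed

text \<open>Moving a point of the bounding hyperplane slightly inwards makes it an interior point.\<close>

lemma half_space_open_subset_closure_interior:
  fixes S :: "(real ^ 'n::finite) set"
  assumes "open S \<or> openin (top_of_set half_space) S"
  shows "S \<subseteq> closure (interior S)"
proof (cases "open S")
  case True
  then show ?thesis by (simp add: interior_open closure_subset)
next
  case False
  then obtain T where T: "open T" "S = half_space \<inter> T" using assms by (auto simp: openin_open)
  let ?P = "{z :: real ^ 'n. 0 < z $ normal_index}"
  have "open ?P" by (simp add: open_halfspace_component_gt_cart)
  then have sub: "?P \<inter> T \<subseteq> interior S"
    by (intro interior_maximal) (use T in \<open>auto simp: half_space_def\<close>)
  show ?thesis
  proof
    fix y assume y: "y \<in> S"
    then obtain \<delta> where \<delta>: "\<delta> > 0" "ball y \<delta> \<subseteq> T" using T open_contains_ball by blast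
    show "y \<in> closure (interior S)"
      unfolding closure_approachable
    proof (intro allI impI)
      fix \<epsilon> :: real assume \<epsilon>: "0 < \<epsilon>"
      let ?t = "min \<delta> \<epsilon> / 2"
      let ?z = "y + ?t *\<^sub>R axis normal_index 1"
      have d: "dist ?z y = ?t" using \<delta>(1) \<epsilon> by (simp add: dist_norm)
      have "?z \<in> ?P \<inter> T"
        using y T \<delta> \<epsilon> d by (auto simp: half_space_def axis_def dist_commute subset_iff)
      then show "\<exists>z\<in>interior S. dist z y < \<epsilon>" using sub d \<delta>(1) \<epsilon> by (intro bexI[of _ ?z]) auto
    qed
  qed
qed

lemma continuous_eq_on_closure_interior:
  fixes f h :: "'a::t2_space \<Rightarrow> 'b::real_normed_vector"
  assumes "continuous_on S f" "continuous_on S h" "U \<subseteq> S" "S \<subseteq> closure U" "\<And>y. y \<in> U \<Longrightarrow> f y = h y" "y \<in> S"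
  shows "f y = h y"
proof -
  have "closedin (top_of_set S) {y \<in> S. f y - h y = 0}"
    by (rule continuous_closedin_preimage_constant) (intro continuous_intros assms)
  then obtain T where T: "closed T" "{y \<in> S. f y - h y = 0} = S \<inter> T" by (auto simp: closedin_closed)
  then have "closure U \<subseteq> T" using assms(3,5) by (intro closure_minimal) auto
  then show ?thesis using T(2) assms(4,6) by auto
qed

section \<open>The Laplacian and its eigenfunctions in a chart\<close>

context riemannian_manifold
begin

text \<open>The coefficients for which the Laplacian is \<^const>\<open>div_grad\<close> divided by the density.\<close>

definition coeff :: "('m, 'n) chart \<Rightarrow> real ^ 'n \<Rightarrow> real ^ 'n ^ 'n" where
  "coeff c y = density_in c y *\<^sub>R matrix_inv (g c (chart_inv c y))"

context
  fixes c assumes c: "c \<in> A"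
begin

lemma Ck_on_metric: "Ck_on k (interior (chart_image c)) (\<lambda>y. g c (chart_inv c y) $ i $ j)"
proof -
  have L: "bounded_linear (\<lambda>B :: real ^ 'n ^ 'n. B $ i $ j)"
    using bounded_linear_compose[OF bounded_linear_vec_nth[of j] bounded_linear_vec_nth[of i]] .
  show ?thesis
    by (rule Ck_on_bounded_linear_comp[OF open_interior L smooth_on_imp_Ck_on[OF smooth_metric[OF c]]])
       (simp_all add: interior_subset)
qed

lemma interior_in: "y \<in> interior (chart_image c) \<Longrightarrow> y \<in> chart_image c"
  using interior_subset by blast

lemma det_metric_interior: "y \<in> interior (chart_image c) \<Longrightarrow> det (g c (chart_inv c y)) > 0"
  by (intro det_metric_pos c chart_inv_in interior_in)

lemma Ck_on_density_in: "Ck_on k (interior (chart_image c)) (density_in c)"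
  unfolding density_in_def
  by (intro Ck_on_sqrt Ck_on_det open_interior Ck_on_metric det_metric_interior)

lemma Ck_on_coeff: "Ck_on k (interior (chart_image c)) (\<lambda>y. coeff c y $ i $ j)"
  unfolding coeff_def vector_scaleR_component real_scaleR_def
  by (intro Ck_on_mult Ck_on_density_in Ck_on_matrix_inv open_interior Ck_on_metric)
     (use det_metric_interior in force)

lemma transpose_coeff: "y \<in> interior (chart_image c) \<Longrightarrow> transpose (coeff c y) = coeff c y"
  using metric_symmetric[OF c chart_inv_in[OF c interior_in]] det_metric_interior
  by (simp add: coeff_def transpose_scalar transpose_matrix_inv invertible_if_det_pos)

lemma laplacian_eq_div_grad:
  assumes y: "y \<in> interior (chart_image c)"
  shows "laplacian g c u (chart_inv c y) = div_grad (coeff c) (u \<circ> chart_inv c) y / density_in c y"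
proof -
  let ?S = "chart_image c"
  have part: "partial ?S i f z = coord_deriv i f z" if "z \<in> interior ?S" for i f z
    using at_within_interior[OF that] by (simp add: partial_def coord_deriv_def)
  have "partial ?S i (\<lambda>z. \<Sum>j\<in>UNIV. sqrt (det (g c (chart_inv c z))) * matrix_inv (g c (chart_inv c z)) $ i $ j * partial ?S j (u \<circ> chart_inv c) z) y
      = coord_deriv i (\<lambda>z. \<Sum>j\<in>UNIV. coeff c z $ i $ j * coord_deriv j (u \<circ> chart_inv c) z) y" for i
    unfolding part[OF y]
    by (rule coord_deriv_cong[OF open_interior y]) (simp add: part coeff_def density_in_def)
  then show ?thesis
    using c interior_in[OF y] by (simp add: laplacian_def Let_def div_grad_def density_in_def)
qed

lemma eigenfunction_in_chart:
  assumes "u \<in> laplace_eigenspace bc A g \<mu>"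
  shows "Ck_on k (interior (chart_image c)) (u \<circ> chart_inv c)"
    and "y \<in> interior (chart_image c) \<Longrightarrow>
      div_grad (coeff c) (u \<circ> chart_inv c) y = - \<mu> * density_in c y * (u \<circ> chart_inv c) y"
proof -
  have "smooth_on (chart_image c) (u \<circ> chart_inv c)"
    using assms c by (auto simp: laplace_eigenspace_def smooth_fun_def)
  then show "Ck_on k (interior (chart_image c)) (u \<circ> chart_inv c)"
    by (rule smooth_on_imp_Ck_on) (auto simp: interior_subset)
  assume y: "y \<in> interior (chart_image c)"
  then have "- laplacian g c u (chart_inv c y) = \<mu> * u (chart_inv c y)"
    using assms c chart_inv_in[OF c interior_in[OF y]] by (auto simp: laplace_eigenspace_def)
  then show "div_grad (coeff c) (u \<circ> chart_inv c) y = - \<mu> * density_in c y * (u \<circ> chart_inv c) y"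
    using laplacian_eq_div_grad[OF y, of u] density_in_pos[OF c interior_in[OF y]]
    by (simp add: field_simps)
qed

text \<open>Completeness of the eigenbasis, tested on functions supported inside one chart.\<close>

lemma orthogonal_in_chart_imp_zero:
  assumes basis: "L2_orthonormal_basis V e"
    and H: "continuous_on (interior (chart_image c)) H" and K: "compact K" "K \<subseteq> interior (chart_image c)"
    and supp: "\<And>y. y \<in> interior (chart_image c) - K \<Longrightarrow> H y = 0"
    and orth: "\<And>j. (\<integral>y. indicator (interior (chart_image c)) y * (density_in c y * H y * (e j \<circ> chart_inv c) y) \<partial>lborel) = 0"
    and y: "y \<in> interior (chart_image c)"
  shows "H y = 0"
proof -
  let ?S = "chart_image c" let ?U = "interior (chart_image c)"
  define h where "h x = indicator (fst c) x *\<^sub>R (indicator ?U (snd c x) * H (snd c x))" for x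
  have Hm: "(\<lambda>y. indicator ?U y * H y) \<in> borel_measurable borel"
    using borel_measurable_continuous_on_indicator[OF _ H] by simp
  have "fst c \<inter> space borelM \<in> sets borelM" using dom_sets[OF c] by (simp add: Int_absorb2[OF dom_subset[OF c]])
  then have hm: "h \<in> borel_measurable borelM"
    using measurable_compose[OF chart_measurable[OF c] Hm]
    unfolding h_def[abs_def] by (subst (asm) borel_measurable_restrict_space_iff) auto
  have h_out: "h x = 0" if "x \<notin> fst c" for x using that by (simp add: h_def)
  have h_in: "h (chart_inv c y) = indicator ?U y * H y" if "y \<in> ?S" for y using that c by (simp add: h_def)
  have wc: "continuous_on ?U (density_in c)"
    by (rule continuous_on_subset[OF continuous_on_density_in[OF c] interior_subset])
  have emeas: "e j \<in> borel_measurable borelM" for j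
    using basis by (auto simp: L2_orthonormal_basis_def L2_def measurable_cong_sets[OF sets_V refl])
  \<comment> \<open>Extended by zero, \<open>H\<close> becomes a square integrable function on the manifold.\<close>
  have sq: "indicator ?S y * (density_in c y * (h (chart_inv c y))\<^sup>2) = indicator ?U y * (density_in c y * (H y)\<^sup>2)" for y
    using h_in[of y] interior_in[of y] by (auto simp: indicator_def)
  have sqm: "(\<lambda>x. (h x)\<^sup>2) \<in> borel_measurable borelM" using hm by simp
  have int: "integrable lborel (\<lambda>y. indicator ?U y * (density_in c y * (H y)\<^sup>2))"
    by (rule integrable_compact_support[OF _ K]) (auto intro!: continuous_intros wc H simp: supp)
  have hL2: "h \<in> L2 V"
    using integral_volume_chart(2)[OF c sqm] h_out int hm
    by (simp add: L2_def sq measurable_cong_sets[OF sets_V refl])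
  have "L2_inner V h (e j) = 0" for j
  proof -
    have m: "(\<lambda>x. h x * e j x) \<in> borel_measurable borelM" using hm emeas by simp
    have "L2_inner V h (e j) = (\<integral>y. indicator ?S y * (density_in c y * (h (chart_inv c y) * e j (chart_inv c y))) \<partial>lborel)"
      unfolding L2_inner_def by (rule integral_volume_chart(1)[OF c m]) (simp add: h_out)
    also have "\<dots> = (\<integral>y. indicator ?U y * (density_in c y * H y * (e j \<circ> chart_inv c) y) \<partial>lborel)"
      by (rule Bochner_Integration.integral_cong) (use h_in interior_in in \<open>auto simp: indicator_def\<close>)
    finally show ?thesis using orth by simp
  qed
  then have "(LINT x|V. (h x)\<^sup>2) = 0" by (rule orthogonal_to_basis_imp_null[OF basis hL2])
  then have "(\<integral>y. indicator ?U y * (density_in c y * (H y)\<^sup>2) \<partial>lborel) = 0"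
    using integral_volume_chart(1)[OF c sqm] h_out by (simp add: sq)
  then have "density_in c y * (H y)\<^sup>2 = 0"
    by (intro continuous_zero_of_integral_zero[OF open_interior _ _ int _ y])
       (auto intro!: continuous_intros wc H mult_nonneg_nonneg less_imp_le[OF density_in_pos[OF c interior_in]])
  then show ?thesis using density_in_pos[OF c interior_in[OF y]] by auto
qed

end

end

section \<open>Recovering the metric\<close>

text \<open>The second family enters through its squares and its eigenvalue equations: it transfers the
  eigenvalue equations of \<open>g'\<close> to the first family, and completeness of the latter does the rest.\<close>

lemma metrics_agree_in_chart_interior:
  fixes A :: "('m, 'n::finite) chart set"
  assumes rm: "riemannian_manifold M A g" "riemannian_manifold M A g'"
    and basis: "L2_orthonormal_basis (riemannian_volume M A g) e"
    and eig: "\<And>j. e j \<in> laplace_eigenspace bc A g (\<mu> j)" "\<And>j. e' j \<in> laplace_eigenspace bc A g' (\<mu> j)"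
    and sq: "\<And>j x. x \<in> topspace M \<Longrightarrow> (e j x)\<^sup>2 = (e' j x)\<^sup>2"
    and c: "c \<in> A" and y0: "y0 \<in> interior (chart_image c)"
  shows "g c (chart_inv c y0) = g' c (chart_inv c y0)"
proof -
  interpret N: riemannian_manifold M A g by (rule rm(1))
  interpret N': riemannian_manifold M A g' by (rule rm(2))
  let ?U = "interior (chart_image c)"
  let ?a = "N.coeff c" and ?b = "N'.coeff c" and ?w = "N.density_in c" and ?w' = "N'.density_in c"
  let ?E = "\<lambda>j. e j \<circ> chart_inv c" and ?E' = "\<lambda>j. e' j \<circ> chart_inv c"
  define r where "r y = ?w y / ?w' y" for y
  have wpos: "?w y > 0" "?w' y > 0" if "y \<in> ?U" for y
    using N.density_in_pos[OF c N.interior_in[OF c that]] N'.density_in_pos[OF c N.interior_in[OF c that]] .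
  have rc: "Ck_on k ?U r" for k
    unfolding r_def[abs_def]
    by (intro Ck_on_divide open_interior N.Ck_on_density_in N'.Ck_on_density_in c) (use wpos in force)
  have sym: "?a z $ i $ j = ?a z $ j $ i" "?b z $ i $ j = ?b z $ j $ i" if "z \<in> ?U" for z i j
  proof -
    have "?a z $ i $ j = transpose (?a z) $ i $ j" "?b z $ i $ j = transpose (?b z) $ i $ j"
      by (simp_all only: N.transpose_coeff[OF c that] N'.transpose_coeff[OF c that])
    then show "?a z $ i $ j = ?a z $ j $ i" "?b z $ i $ j = ?b z $ j $ i" by (simp_all add: transpose_def)
  qed
  have transfer: "div_grad ?b (?E j) y = - \<mu> j * ?w' y * (?E j) y" if "y \<in> ?U" for j y
  proof (rule eigenfunction_transfer_of_equal_squares[OF open_interior N'.Ck_on_coeff[OF c]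
        N.eigenfunction_in_chart(1)[OF c eig(1)] N'.eigenfunction_in_chart(1)[OF c eig(2)]])
    show "continuous_on ?U (\<lambda>y. - \<mu> j * ?w' y)"
      using Ck_on_imp_continuous_on[OF N'.Ck_on_density_in[OF c]] by (auto intro!: continuous_intros)
    show "(?E j z)\<^sup>2 = (?E' j z)\<^sup>2" if "z \<in> ?U" for z
      using sq N.dom_subset[OF c] N.chart_inv_in[OF c N.interior_in[OF c that]] by auto
    show "div_grad ?b (?E' j) z = - \<mu> j * ?w' z * ?E' j z" if "z \<in> ?U" for z
      by (rule N'.eigenfunction_in_chart(2)[OF c eig(2) that])
    show "y \<in> ?U" by fact
  qed
  have "?a y0 = r y0 *\<^sub>R ?b y0"
  proof (rule div_grad_determines_coefficients[OF open_interior y0 N.Ck_on_coeff[OF c] N'.Ck_on_coeff[OF c]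
        N.transpose_coeff[OF c y0] N'.transpose_coeff[OF c y0] rc])
    fix \<psi> :: "real ^ 'n \<Rightarrow> real" and K assume \<psi>: "Ck_on 2 ?U \<psi>" and K: "compact K" "K \<subseteq> ?U" and supp: "\<And>x. x \<in> ?U - K \<Longrightarrow> \<psi> x = 0"
    define \<psi>' where "\<psi>' y = \<psi> y * r y" for y
    have \<psi>': "Ck_on 2 ?U \<psi>'" unfolding \<psi>'_def[abs_def] by (intro Ck_on_mult open_interior \<psi> rc)
    have supp': "\<psi>' x = 0" if "x \<in> ?U - K" for x using supp[OF that] by (simp add: \<psi>'_def)
    have E: "Ck_on 2 ?U (?E j)" for j by (rule N.eigenfunction_in_chart(1)[OF c eig(1)])
    have open': "open (?U - K)" using K(1) by (simp add: compact_imp_closed open_Diff)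
    have cdg: "continuous_on ?U (div_grad ?a \<psi>)" "continuous_on ?U (div_grad ?b \<psi>')"
      using Ck_on_div_grad[OF open_interior N.Ck_on_coeff[OF c], of 0] Ck_on_div_grad[OF open_interior N'.Ck_on_coeff[OF c], of 0] \<psi> \<psi>'
      by (simp_all add: numeral_2_eq_2)
    have dg0: "div_grad ?a \<psi> x = 0" "div_grad ?b \<psi>' x = 0" if "x \<in> ?U - K" for x
      using div_grad_cong[OF open' that, of \<psi> "\<lambda>_. 0"] div_grad_cong[OF open' that, of \<psi>' "\<lambda>_. 0"] supp supp'
      by (simp_all add: div_grad_0)
    have cE: "continuous_on ?U (?E j)" for j using Ck_on_imp_continuous_on[OF E] .
    have cw: "continuous_on ?U ?w" using Ck_on_imp_continuous_on[OF N.Ck_on_density_in[OF c]] .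
    \<comment> \<open>Orthogonality of \<open>H\<close> to the basis for the volume of \<open>g\<close>: moving both operators to \<open>e\<^sub>j\<close>, the
      factor \<open>r = w / w'\<close> in \<open>\<psi>'\<close> turns \<open>w'\<close> into \<open>w\<close> and the two terms cancel.\<close>
    define H where "H y = (div_grad ?a \<psi> y - div_grad ?b \<psi>' y) / ?w y" for y
    have wH: "?w y * H y = div_grad ?a \<psi> y - div_grad ?b \<psi>' y" if "y \<in> ?U" for y
      using wpos(1)[OF that] by (simp add: H_def)
    have "H y0 = 0"
    proof (rule N.orthogonal_in_chart_imp_zero[OF c basis[folded N.V_def] _ K _ _ y0])
      show "continuous_on ?U H" unfolding H_def[abs_def]
        using wpos by (intro continuous_intros cdg cw) force
      show "H y = 0" if "y \<in> ?U - K" for y using dg0[OF that] by (simp add: H_def)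
      fix j
      have i1: "integrable lborel (\<lambda>y. indicator ?U y * (?E j y * div_grad ?a \<psi> y))"
        by (rule integrable_compact_support[OF _ K]) (auto intro!: continuous_intros cE[unfolded o_def] cdg simp: dg0)
      have i2: "integrable lborel (\<lambda>y. indicator ?U y * (?E j y * div_grad ?b \<psi>' y))"
        by (rule integrable_compact_support[OF _ K]) (auto intro!: continuous_intros cE[unfolded o_def] cdg simp: dg0)
      have "(\<integral>y. indicator ?U y * (?w y * H y * ?E j y) \<partial>lborel) =
        (\<integral>y. indicator ?U y * (?E j y * div_grad ?a \<psi> y) - indicator ?U y * (?E j y * div_grad ?b \<psi>' y) \<partial>lborel)"
        by (rule Bochner_Integration.integral_cong) (auto simp: wH indicator_def left_diff_distrib mult.commute[of _ "div_grad _ _ _"])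
      also have "\<dots> = (\<integral>y. indicator ?U y * (?E j y * div_grad ?a \<psi> y) \<partial>lborel) - (\<integral>y. indicator ?U y * (?E j y * div_grad ?b \<psi>' y) \<partial>lborel)"
        by (rule Bochner_Integration.integral_diff[OF i1 i2])
      also have "(\<integral>y. indicator ?U y * (?E j y * div_grad ?a \<psi> y) \<partial>lborel) = (\<integral>y. indicator ?U y * (div_grad ?a (?E j) y * \<psi> y) \<partial>lborel)"
        by (rule green_compact_support[OF open_interior N.Ck_on_coeff[OF c] sym(1) E \<psi> K supp])
      also have "(\<integral>y. indicator ?U y * (?E j y * div_grad ?b \<psi>' y) \<partial>lborel) = (\<integral>y. indicator ?U y * (div_grad ?b (?E j) y * \<psi>' y) \<partial>lborel)"
        by (rule green_compact_support[OF open_interior N'.Ck_on_coeff[OF c] sym(2) E \<psi>' K supp'])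
      also have "\<dots> = (\<integral>y. indicator ?U y * (div_grad ?a (?E j) y * \<psi> y) \<partial>lborel)"
      proof (rule Bochner_Integration.integral_cong[OF refl])
        fix y
        show "indicator ?U y * (div_grad ?b (?E j) y * \<psi>' y) = indicator ?U y * (div_grad ?a (?E j) y * \<psi> y)"
        proof (cases "y \<in> ?U")
          case True
          then show ?thesis
            unfolding transfer[OF True] N.eigenfunction_in_chart(2)[OF c eig(1) True]
            using wpos[OF True] by (simp add: \<psi>'_def r_def)
        qed simp
      qed
      finally show "(\<integral>y. indicator ?U y * (?w y * H y * ?E j y) \<partial>lborel) = 0" unfolding diff_self .
    qed
    then show "div_grad ?a \<psi> y0 = div_grad ?b (\<lambda>y. \<psi> y * r y) y0"
      using wpos[OF y0] by (simp add: H_def \<psi>'_def[abs_def])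
  qed
  then have "matrix_inv (g c (chart_inv c y0)) = matrix_inv (g' c (chart_inv c y0))"
  proof -
    have "?w y0 *\<^sub>R matrix_inv (g c (chart_inv c y0)) = (r y0 * ?w' y0) *\<^sub>R matrix_inv (g' c (chart_inv c y0))"
      using \<open>?a y0 = r y0 *\<^sub>R ?b y0\<close> unfolding N.coeff_def N'.coeff_def scaleR_scaleR .
    moreover have "r y0 * ?w' y0 = ?w y0" using wpos(2)[OF y0] by (simp add: r_def)
    ultimately show ?thesis using wpos(1)[OF y0] by simp
  qed
  then show ?thesis
    by (rule matrix_inv_injective[OF invertible_if_det_pos[OF N.det_metric_interior[OF c y0]]
        invertible_if_det_pos[OF N'.det_metric_interior[OF c y0]]])
qed

theorem theorem1:
  fixes M :: "'m topology"
    and A :: "('m, 'n::finite) chart set"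
    and bc :: boundary_condition
    and g g' :: "('m, 'n) tensor2"
    and lam lam' :: "nat \<Rightarrow> real"
    and e e' :: "nat \<Rightarrow> 'm \<Rightarrow> real"
  assumes "smooth_manifold M A" and "compact_space M" and "connected_space M"
    and "riemannian_metric A g" and "riemannian_metric A g'"
    and "simple_spectrum bc M A g" and "simple_spectrum bc M A g'"
    and "laplace_eigenbasis bc M A g lam e" and "laplace_eigenbasis bc M A g' lam' e'"
    and "\<And>x l. x \<in> topspace M \<Longrightarrow> local_weyl lam e x l = local_weyl lam' e' x l"
  shows "\<forall>c\<in>A. \<forall>x\<in>fst c. g c x = g' c x"
proof (intro ballI)
  interpret N: riemannian_manifold M A g by standard fact+
  interpret N': riemannian_manifold M A g' by standard fact+
  have sp: "space (riemannian_volume M A g) = topspace M" "space (riemannian_volume M A g') = topspace M"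
    using N.space_V N'.space_V by (simp_all add: N.V_def N'.V_def)
  have on: "L2_orthonormal_basis (riemannian_volume M A g) e" "L2_orthonormal_basis (riemannian_volume M A g') e'"
    and eig: "\<And>j. e j \<in> laplace_eigenspace bc A g ((lam j)\<^sup>2)" "\<And>j. e' j \<in> laplace_eigenspace bc A g' ((lam' j)\<^sup>2)"
    using assms(8,9) by (auto simp: laplace_eigenbasis_def)
  have same: "lam j = lam' j \<and> (\<forall>x\<in>topspace M. (e j x)\<^sup>2 = (e' j x)\<^sup>2)" for j
  proof (rule local_weyl_determines_frequencies_and_squares)
    show "strict_mono lam" by (rule simple_spectrum_strict_mono[OF assms(6,8) sp(1)])
    show "strict_mono lam'" by (rule simple_spectrum_strict_mono[OF assms(7,9) sp(2)])
    show "\<exists>x\<in>topspace M. e j x \<noteq> 0" "\<exists>x\<in>topspace M. e' j x \<noteq> 0" for j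
      using orthonormal_nonzero[OF on(1)] orthonormal_nonzero[OF on(2)] by (simp_all add: sp)
  qed (rule assms(10))
  fix c x assume c: "c \<in> A" and x: "x \<in> fst c"
  have "g c (chart_inv c (snd c x)) = g' c (chart_inv c (snd c x))"
  proof (rule continuous_eq_on_closure_interior[where f = "\<lambda>y. g c (chart_inv c y)" and h = "\<lambda>y. g' c (chart_inv c y)"
        and S = "chart_image c" and U = "interior (chart_image c)"])
    show "continuous_on (chart_image c) (\<lambda>y. g c (chart_inv c y))" "continuous_on (chart_image c) (\<lambda>y. g' c (chart_inv c y))"
      using N.smooth_metric[OF c] N'.smooth_metric[OF c] smooth_on_imp_continuous_on by blast+
    show "chart_image c \<subseteq> closure (interior (chart_image c))"
      by (rule half_space_open_subset_closure_interior[OF N.image_open[OF c]])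
    show "g c (chart_inv c y) = g' c (chart_inv c y)" if "y \<in> interior (chart_image c)" for y
      by (rule metrics_agree_in_chart_interior[OF N.riemannian_manifold_axioms N'.riemannian_manifold_axioms on(1) eig(1) _ _ c that])
         (use eig(2) same in auto)
  qed (use c x interior_subset in auto)
  then show "g c x = g' c x" using c x by simp
qed

end
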